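(* Let solutions $\psi_n$ of the KG equation concentrate at the trajectory $\hat{\mathbf r}$, let $t_0$ be the time in condition (iv), and suppose $\bar\rho_n(t_0)\to\bar\rho_\infty$. Then the restricted energy converges uniformly: $\bar{\mathcal E}_n(t)\to\bar{\mathcal E}_\infty(t)$ uniformly on $[T_-,T_+]$, where $$\bar{\mathcal E}_\infty(t)=\bar{\mathcal E}_\infty(t_0)-\bar\rho_\infty\int_{t_0}^t\partial_t\hat{\mathbf r}(t')\cdot\nabla\varphi_\infty(t')\,dt'.$$
   Context: Fix constants $c>0$, $m>0$ and a real charge $q$. For parameters $\chi>0$, $a>0$ and a real electric potential $\varphi(t,\mathbf x)$, $\mathbf x\in\mathbb R^3$, the KG equation for complex $\psi$ is $-c^{-2}\tilde\partial_t^2\psi+\Delta\psi-G_a'(|\psi|^2)\psi-\kappa_0^2\psi=0$, where $\tilde\partial_t=\partial_t+\mathrm i q\varphi/\chi$, $\kappa_0=mc/\chi$. Here $G_a(s)=a^{-5}G_1(a^3s)$, where $G_1(0)=0$, $G_1'\in C^1((0,\infty))$, the map $\psi\mapsto G_1'(|\psi|^2)\psi$ extends to a $C^\alpha(\mathbb C)$ function and $\psi\mapsto G_1(|\psi|^2)$ is $C^{1+\alpha}(\mathbb C)$ for every $\alpha\in(0,1)$, and for every $C_1$ there is $C$ with $|G_1(|\psi|^2)|\le C|\psi|^{1+\alpha}$, $|G_1'(|\psi|^2)||\psi|\le C|\psi|^\alpha$ for $|\psi|\le C_1$. Put $a_C=\chi/(mc)$. Charge density: $\rho=-\frac{\chi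 q}{mc^2}\operatorname{Im}(\psi^*\tilde\partial_t\psi)$. Energy density: $\mathcal E=\frac{\chi^2}{2m}\big[c^{-2}|\tilde\partial_t\psi|^2+|\nabla\psi|^2+G_a(|\psi|^2)+\kappa_0^2|\psi|^2\big]$. Write $\nabla_{0,\mathbf x}=(c^{-1}\partial_t,\partial_1,\partial_2,\partial_3)$. Trajectory: $\hat{\mathbf r}\in C^2([T_-,T_+];\mathbb R^3)$ with $|\partial_t\hat{\mathbf r}|,|\partial_t^2\hat{\mathbf r}|\le C$. For $R_n>0$, $R_n\to0$, let $\Omega_n(t)=\{\mathbf x:|\mathbf x-\hat{\mathbf r}(t)|\le R_n\}$ and $\hat\Omega_n=\{(t,\mathbf x):T_-\le t\le T_+,\ \mathbf x\in\Omega_n(t)\}$. Localized KG equations: sequences $a_n\to0$, $\chi_n\to0$ with $a_{C,n}/a_n\le C$ and $R_n/a_n\to\infty$, and potentials $\varphi_n\in C^2(\hat\Omega_n)$ with $\sup_{\hat\Omega_n}(|\varphi_n|+|\nabla_{0,\mathbf x}\varphi_n|)\le C$ uniformly in $n$, and a limit potential $\varphi_\infty(t,\mathbf x)=\varphi_\infty(t,\hat{\mathbf r}(t))+(\mathbf x-\hat{\mathbf r}(t))\cdot\nabla\varphi_\infty(t)$ such that $\sup_{\hat\Omega_n}(|\varphi_n-\varphi_\infty|+|\nabla_{0,\mathbf x}\varphi_n-\nabla_{0,\mathbf x}\varphi_\infty|)\to0$ and $|\varphi_\infty(t,\hat{\mathbf r}(t))|,|\nabla\varphi_\infty(t)|,|\partial_t\nabla\varphi_\infty(t)|\le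 C$. Concentrating solutions: for such a localized sequence, functions $\psi_n\in C^2(\hat\Omega_n)$ solving the KG equation with parameters $(\chi_n,a_n,\varphi_n)$ in $\hat\Omega_n$ such that: (i) $\max_t\int_{\Omega_n(t)}[a_C^2|\nabla_{0,\mathbf x}\psi_n|^2+a_C^2|G_a(|\psi_n|^2)|+|\psi_n|^2]\,d^3x\le C$; (ii) $\max_t\int_{\partial\Omega_n(t)}[a_C^2|\nabla_{0,\mathbf x}\psi_n|^2+a_C^2|G_a(|\psi_n|^2)|+|\psi_n|^2]\,d^2\sigma\to0$; (iii) the restricted energy $\bar{\mathcal E}_n(t)=\int_{\Omega_n(t)}\mathcal E_n\,d^3x$ satisfies $\bar{\mathcal E}_n(t)\ge c_0>0$ for $n\ge n_0$, $t\in[T_-,T_+]$; (iv) there is $t_0\in[T_-,T_+]$ with $\bar{\mathcal E}_n(t_0)\to\bar{\mathcal E}_\infty(t_0)$. Restricted charge: $\bar\rho_n(t)=\int_{\Omega_n(t)}\rho_n\,d^3x$. *)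

theory Defs
  imports "HOL-Analysis.Analysis"
begin

text \<open>Space-time points are pairs (t, x) with x :: real^3.  All derivatives of fields
  defined on a closed space-time region S are Frechet derivatives taken within S.\<close>

type_synonym st = "real \<times> (real^3)"

definition C2_within :: "('a::real_normed_vector \<Rightarrow> 'b::real_normed_vector) \<Rightarrow> 'a set \<Rightarrow> bool" where
  "C2_within f S \<longleftrightarrow>
     (\<exists>D D2. (\<forall>z\<in>S. (f has_derivative blinfun_apply (D z)) (at z within S)) \<and>
             (\<forall>z\<in>S. (D has_derivative blinfun_apply (D2 z)) (at z within S)) \<and>
             continuous_on S D2)"

definition locally_holder :: "real \<Rightarrow> ('a::metric_space \<Rightarrow> 'b::metric_space) \<Rightarrow> bool" where
  "locally_holder al f \<longleftrightarrow>
     (\<forall>K. compact K \<longrightarrow> (\<exists>L. \<forall>x\<in>K. \<forall>y\<in>K. dist (f x) (f y) \<le> L * dist x y powr al))"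

definition C1_holder :: "real \<Rightarrow> ('a::real_normed_vector \<Rightarrow> 'b::real_normed_vector) \<Rightarrow> bool" where
  "C1_holder al f \<longleftrightarrow>
     (\<exists>D. (\<forall>z. (f has_derivative blinfun_apply (D z)) (at z)) \<and> locally_holder al D)"

definition pdt :: "st set \<Rightarrow> (st \<Rightarrow> 'b::real_normed_vector) \<Rightarrow> st \<Rightarrow> 'b" where
  "pdt S f z = frechet_derivative f (at z within S) (1, 0)"

definition pdx :: "st set \<Rightarrow> 3 \<Rightarrow> (st \<Rightarrow> 'b::real_normed_vector) \<Rightarrow> st \<Rightarrow> 'b" where
  "pdx S i f z = frechet_derivative f (at z within S) (0, axis i 1)"

definition grad :: "st set \<Rightarrow> (st \<Rightarrow> 'b::real_normed_vector) \<Rightarrow> st \<Rightarrow> 'b^3" where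
  "grad S f z = (\<chi> i. pdx S i f z)"

text \<open>nabla_{0,x} f = (c^{-1} d_t f, d_1 f, d_2 f, d_3 f); its Euclidean norm is the norm
  of this pair.\<close>
definition grad0 :: "real \<Rightarrow> st set \<Rightarrow> (st \<Rightarrow> 'b::real_normed_vector) \<Rightarrow> st \<Rightarrow> 'b \<times> ('b^3)" where
  "grad0 c S f z = (inverse c *\<^sub>R pdt S f z, grad S f z)"

definition lap :: "st set \<Rightarrow> (st \<Rightarrow> 'b::real_normed_vector) \<Rightarrow> st \<Rightarrow> 'b" where
  "lap S f z = (\<Sum>i\<in>UNIV. pdx S i (pdx S i f) z)"

definition tdt :: "st set \<Rightarrow> real \<Rightarrow> real \<Rightarrow> (st \<Rightarrow> real) \<Rightarrow> (st \<Rightarrow> complex) \<Rightarrow> st \<Rightarrow> complex" where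
  "tdt S q chi phi f z = pdt S f z + \<i> * complex_of_real (q * phi z / chi) * f z"

definition Ga :: "(real \<Rightarrow> real) \<Rightarrow> real \<Rightarrow> real \<Rightarrow> real" where
  "Ga G1 a s = G1 (a ^ 3 * s) / a ^ 5"

text \<open>G_a'(|w|^2) w, where G_a'(s) = a^{-2} G_1'(a^3 s) and dG1 is G_1'.\<close>
definition Nl :: "(real \<Rightarrow> real) \<Rightarrow> real \<Rightarrow> complex \<Rightarrow> complex" where
  "Nl dG1 a w = complex_of_real (dG1 (a ^ 3 * (cmod w)\<^sup>2) / a ^ 2) * w"

definition kappa0 :: "real \<Rightarrow> real \<Rightarrow> real \<Rightarrow> real" where
  "kappa0 m c chi = m * c / chi"

definition aC :: "real \<Rightarrow> real \<Rightarrow> real \<Rightarrow> real" where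
  "aC m c chi = chi / (m * c)"

definition KG_eq :: "real \<Rightarrow> real \<Rightarrow> real \<Rightarrow> (real \<Rightarrow> real) \<Rightarrow> real \<Rightarrow> real \<Rightarrow> (st \<Rightarrow> real)
                     \<Rightarrow> st set \<Rightarrow> (st \<Rightarrow> complex) \<Rightarrow> bool" where
  "KG_eq c m q dG1 chi a phi S psi \<longleftrightarrow>
     (\<forall>z\<in>S. - tdt S q chi phi (tdt S q chi phi psi) z / complex_of_real (c ^ 2)
            + lap S psi z - Nl dG1 a (psi z)
            - complex_of_real ((kappa0 m c chi) ^ 2) * psi z = 0)"

definition charge_density :: "real \<Rightarrow> real \<Rightarrow> real \<Rightarrow> real \<Rightarrow> (st \<Rightarrow> real) \<Rightarrow> st set
                               \<Rightarrow> (st \<Rightarrow> complex) \<Rightarrow> st \<Rightarrow> real" where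
  "charge_density c m q chi phi S psi z =
     - (chi * q / (m * c ^ 2)) * Im (cnj (psi z) * tdt S q chi phi psi z)"

definition energy_density :: "real \<Rightarrow> real \<Rightarrow> real \<Rightarrow> (real \<Rightarrow> real) \<Rightarrow> real \<Rightarrow> real \<Rightarrow> (st \<Rightarrow> real)
                               \<Rightarrow> st set \<Rightarrow> (st \<Rightarrow> complex) \<Rightarrow> st \<Rightarrow> real" where
  "energy_density c m q G1 chi a phi S psi z =
     chi ^ 2 / (2 * m) *
       ((cmod (tdt S q chi phi psi z))\<^sup>2 / c ^ 2 + (norm (grad S psi z))\<^sup>2
        + Ga G1 a ((cmod (psi z))\<^sup>2) + (kappa0 m c chi) ^ 2 * (cmod (psi z))\<^sup>2)"

definition OmegaHat :: "real \<Rightarrow> real \<Rightarrow> (real \<Rightarrow> real^3) \<Rightarrow> real \<Rightarrow> st set" where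
  "OmegaHat Tm Tp rhat r = {(t, x). t \<in> {Tm..Tp} \<and> x \<in> cball (rhat t) r}"

definition sph :: "real \<Rightarrow> real \<Rightarrow> real^3" where
  "sph th ph = vector [sin th * cos ph, sin th * sin ph, cos th]"

definition sphere_integral :: "real^3 \<Rightarrow> real \<Rightarrow> (real^3 \<Rightarrow> real) \<Rightarrow> real" where
  "sphere_integral p r f =
     r ^ 2 * integral ({0..pi} \<times> {0..2*pi}) (\<lambda>(th, ph). sin th * f (p + r *\<^sub>R sph th ph))"

end

theory Submission
  imports Defs
begin

text \<open>
  A solution satisfies the local balance laws \<open>\<partial>\<^sub>t E = div P - J \<bullet> \<nabla>\<phi>\<close> and
  \<open>\<partial>\<^sub>t \<rho> = - div J\<close>.  Integrated over the moving balls, by Gauss' theorem, every flux term is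
  controlled by the vanishing boundary integral of condition (ii); hence the restricted charge
  converges uniformly to \<open>\<rho>\<^sub>\<infinity>\<close> and, up to small terms, the restricted energy has the
  derivative \<open>- \<nabla>\<phi>\<^sub>\<infinity>(t) \<bullet> \<integral> J\<close>.  The total current is found from the first moment
  \<open>M(t) = \<integral> (x - r(t)) \<rho>\<close>, for which \<open>M' = \<integral> J - r' \<integral> \<rho>\<close> up to a flux; since
  \<open>|x - r| \<le> R\<^sub>n\<close> in the ball, \<open>M\<close> tends to zero.  So
  \<open>\<integral> E + \<nabla>\<phi>\<^sub>\<infinity> \<bullet> M + \<rho>\<^sub>\<infinity> \<integral> r' \<bullet> \<nabla>\<phi>\<^sub>\<infinity>\<close> has a uniformly small derivative,
  and the mean value theorem concludes without integrating the derivative of \<open>\<nabla>\<phi>\<^sub>\<infinity>\<close>,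
  which need not be continuous.
\<close>

section \<open>Spherical coordinates\<close>

text \<open>Derivatives in the definitions are taken within the closed tube and selected by
  \<open>frechet_derivative\<close>. They can be computed only once they are known to be unique up
  to the lateral boundary and the end times, and the energy law also needs mixed second derivatives
  to commute there. Surface integrals are given by a formula in the spherical angles, so Gauss'
  theorem is proved in spherical coordinates; these also turn the ball at every time into one fixed
  box, so that differentiation under the integral sign handles the moving domain. The local laws
  come from pairing the equation with the covariant time derivative (energy) and with
  \<open>\<i> * psi\<close> (charge); the electric force is the commutator of the covariant time
  derivative with the spatial gradient. The nonlinear potential has no sign, so every density is
  compared with the density of conditions (i) and (ii) and not with the energy itself. The factors
  chi cancel in these comparisons, which makes all constants independent of n.\<close>

lemma sph_nth [simp]:
  "sph th ph $ 1 = sin th * cos ph" "sph th ph $ 2 = sin th * sin ph" "sph th ph $ 3 = cos th"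
  by (simp_all add: sph_def)

lemma inner_real3: "(x::real^3) \<bullet> y = x $ 1 * y $ 1 + x $ 2 * y $ 2 + x $ 3 * y $ 3"
  by (simp add: inner_vec_def sum_3)

lemma norm_sph [simp]: "norm (sph th ph) = 1"
proof -
  have "sph th ph \<bullet> sph th ph = (sin th)\<^sup>2 * ((cos ph)\<^sup>2 + (sin ph)\<^sup>2) + (cos th)\<^sup>2"
    unfolding inner_real3 sph_nth by algebra
  then show ?thesis by (simp add: norm_eq_sqrt_inner)
qed

definition sph_th :: "real \<Rightarrow> real \<Rightarrow> real^3" where
  "sph_th th ph = vector [cos th * cos ph, cos th * sin ph, - sin th]"

text \<open>The azimuthal derivative of \<open>sph\<close> divided by \<open>sin th\<close>. With
  this normalisation \<open>sph\<close>, \<open>sph_th\<close>, \<open>sph_ph\<close> form an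
  orthonormal frame even at the poles.\<close>

definition sph_ph :: "real \<Rightarrow> real^3" where
  "sph_ph ph = vector [- sin ph, cos ph, 0]"

lemma sph_frame_nth [simp]:
  "sph_th th ph $ 1 = cos th * cos ph" "sph_th th ph $ 2 = cos th * sin ph" "sph_th th ph $ 3 = - sin th"
  "sph_ph ph $ 1 = - sin ph" "sph_ph ph $ 2 = cos ph" "sph_ph ph $ 3 = 0"
  by (simp_all add: sph_th_def sph_ph_def)

lemma has_derivative_vec3I:
  fixes f :: "'a::real_normed_vector \<Rightarrow> real^3"
  assumes "\<And>i. ((\<lambda>x. f x $ i) has_derivative (\<lambda>h. f' h $ i)) (at a within S)"
  shows "(f has_derivative f') (at a within S)"
  unfolding has_derivative_componentwise_within[of f]
  using assms by (auto simp: Basis_vec_def inner_axis)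

lemma continuous_on_vec3I:
  fixes f :: "'a::topological_space \<Rightarrow> real^3"
  assumes "\<And>i. continuous_on S (\<lambda>x. f x $ i)"
  shows "continuous_on S f"
  using continuous_on_vec_lambda[of S "\<lambda>i x. f x $ i", OF assms] by simp

lemma has_derivative_sph:
  assumes "(f has_derivative f') (at a within S)" "(g has_derivative g') (at a within S)"
  shows "((\<lambda>x. sph (f x) (g x)) has_derivative
           (\<lambda>h. f' h *\<^sub>R sph_th (f a) (g a) + (sin (f a) * g' h) *\<^sub>R sph_ph (g a))) (at a within S)"
proof (rule has_derivative_vec3I)
  fix i :: 3
  note d = assms[THEN DERIV_sin[THEN DERIV_compose_FDERIV]] assms[THEN DERIV_cos[THEN DERIV_compose_FDERIV]]
  show "((\<lambda>x. sph (f x) (g x) $ i) has_derivative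
         (\<lambda>h. (f' h *\<^sub>R sph_th (f a) (g a) + (sin (f a) * g' h) *\<^sub>R sph_ph (g a)) $ i)) (at a within S)"
    using exhaust_3[of i]
    by (elim disjE) (auto intro!: derivative_eq_intros assms d simp: algebra_simps)
qed

lemma has_derivative_spherical:
  "((\<lambda>u::real^3. p + u $ 1 *\<^sub>R sph (u $ 2) (u $ 3)) has_derivative
     (\<lambda>h. h $ 1 *\<^sub>R sph (u $ 2) (u $ 3) + u $ 1 *\<^sub>R (h $ 2 *\<^sub>R sph_th (u $ 2) (u $ 3)
           + (sin (u $ 2) * h $ 3) *\<^sub>R sph_ph (u $ 3)))) (at u within S)"
  by (rule derivative_eq_intros has_derivative_sph bounded_linear_imp_has_derivative bounded_linear_vec_nth refl | simp add: algebra_simps)+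

lemma det_spherical:
  "det (matrix (\<lambda>h::real^3. h $ 1 *\<^sub>R sph th ph + r *\<^sub>R (h $ 2 *\<^sub>R sph_th th ph
           + (sin th * h $ 3) *\<^sub>R sph_ph ph))) = r\<^sup>2 * sin th"
proof -
  have *: "(sin th)\<^sup>2 + (cos th)\<^sup>2 = 1" "(sin ph)\<^sup>2 + (cos ph)\<^sup>2 = 1"
    by auto
  show ?thesis
    unfolding det_3 matrix_def
    by (simp add: axis_def) (use * in algebra)
qed

lemma continuous_on_sph [continuous_intros]:
  fixes f :: "'a::t2_space \<Rightarrow> real"
  assumes "continuous_on S f" "continuous_on S g"
  shows "continuous_on S (\<lambda>x. sph (f x) (g x))"
proof (rule continuous_on_vec3I)
  fix i :: 3
  show "continuous_on S (\<lambda>x. sph (f x) (g x) $ i)"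
    using exhaust_3[of i] by (elim disjE) (auto intro!: continuous_on_mult continuous_on_sin continuous_on_cos assms)
qed

text \<open>The norm recovers the radius and the third component the polar angle, since cos is
  injective on [0, pi]. Dividing by \<open>sin th > 0\<close> gives cos and sin of the azimuth,
  hence the azimuth up to multiples of 2 pi, and the open interval leaves only the multiple
  0.\<close>

lemma inj_on_spherical:
  "inj_on (\<lambda>u::real^3. p + u $ 1 *\<^sub>R sph (u $ 2) (u $ 3)) {u. 0 < u $ 1 \<and> u $ 2 \<in> {0<..<pi} \<and> u $ 3 \<in> {0<..<2*pi}}"
proof (rule inj_onI, clarsimp)
  fix u v :: "real^3"
  assume uv: "0 < u $ 1" "0 < v $ 1" "0 < u $ 2" "u $ 2 < pi" "0 < v $ 2" "v $ 2 < pi"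
     "0 < u $ 3" "u $ 3 < 2 * pi" "0 < v $ 3" "v $ 3 < 2 * pi"
    and eq: "u $ 1 *\<^sub>R sph (u $ 2) (u $ 3) = v $ 1 *\<^sub>R sph (v $ 2) (v $ 3)"
  have 1: "u $ 1 = v $ 1"
    using arg_cong[OF eq, of norm] uv by simp
  with eq uv have s: "sph (u $ 2) (u $ 3) = sph (v $ 2) (v $ 3)" by simp
  have "cos (u $ 2) = cos (v $ 2)" using arg_cong[OF s, of "\<lambda>w. w $ 3"] by simp
  then have 2: "u $ 2 = v $ 2" using uv cos_inj_pi by (meson less_imp_le)
  have sp: "sin (v $ 2) > 0" using uv sin_gt_zero by blast
  have c: "cos (u $ 3) = cos (v $ 3)" and sn: "sin (u $ 3) = sin (v $ 3)"
    using arg_cong[OF s, of "\<lambda>w. w $ 1"] arg_cong[OF s, of "\<lambda>w. w $ 2"] 2 sp by auto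
  have 3: "u $ 3 = v $ 3"
  proof -
    have "cos (u $ 3 - v $ 3) = 1"
      using c sn by (simp add: cos_diff flip: power2_eq_square)
    then obtain k :: int where k: "u $ 3 - v $ 3 = of_int k * (2 * pi)"
      using cos_one_2pi_int by (metis mult.assoc mult.commute)
    have "\<bar>of_int k * (2 * pi)\<bar> < 1 * (2 * pi)" using uv unfolding k[symmetric] by (auto simp: abs_if)
    then have "\<bar>real_of_int k\<bar> < 1" by (simp add: abs_mult)
    then have "k = 0" by linarith
    with k show ?thesis by simp
  qed
  show "u = v" using 1 2 3 by (simp add: vec_eq_iff forall_3)
qed

text \<open>The plane through p normal to the second axis contains both the polar axis and the
  half-plane of azimuth 0, the places where the coordinates degenerate. Excluding the whole plane
  costs only a negligible set.\<close>

lemma spherical_image: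
  fixes p :: "real^3"
  assumes "x \<in> ball p R" "x $ 2 \<noteq> p $ 2"
  obtains r th ph where "0 < r" "r < R" "0 < th" "th < pi" "0 < ph" "ph < 2 * pi" "x = p + r *\<^sub>R sph th ph"
proof -
  define y where "y = x - p"
  define r where "r = norm y"
  have y2: "y $ 2 \<noteq> 0" using assms by (simp add: y_def)
  then have r0: "r > 0" by (auto simp: r_def)
  have rR: "r < R" using assms by (simp add: r_def y_def dist_norm norm_minus_commute)
  have rr: "r\<^sup>2 = (y $ 1)\<^sup>2 + (y $ 2)\<^sup>2 + (y $ 3)\<^sup>2"
    unfolding r_def power2_norm_eq_inner inner_real3 by (simp add: power2_eq_square)
  define th where "th = arccos (y $ 3 / r)"
  define s where "s = sqrt ((y $ 1)\<^sup>2 + (y $ 2)\<^sup>2)"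
  have s2: "s\<^sup>2 = (y $ 1)\<^sup>2 + (y $ 2)\<^sup>2" by (simp add: s_def)
  have s0: "s > 0" using y2 by (auto simp: s_def intro!: add_nonneg_pos)
  have "(y $ 3)\<^sup>2 < r\<^sup>2" using rr s2 s0 by (smt (verit) zero_less_power)
  then have "\<bar>y $ 3\<bar> < r" using r0 by (metis abs_of_pos abs_le_square_iff not_less)
  then have b: "-1 < y $ 3 / r" "y $ 3 / r < 1" using r0 by (auto simp: field_simps)
  have th: "0 < th" "th < pi" "cos th = y $ 3 / r"
    using arccos_lt_bounded[OF b] b by (auto simp: th_def)
  have sinth: "r * sin th = s"
  proof -
    have "(r * sin th)\<^sup>2 = r\<^sup>2 - (r * cos th)\<^sup>2"
      by (simp add: power_mult_distrib sin_squared_eq algebra_simps)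
    also have "\<dots> = s\<^sup>2" using r0 rr s2 by (simp add: th(3))
    finally show ?thesis using s0 r0 sin_gt_zero[OF th(1,2)]
      by (metis less_imp_le mult_pos_pos power2_eq_imp_eq)
  qed
  have "(y $ 1 / s)\<^sup>2 + (y $ 2 / s)\<^sup>2 = 1"
    using s0 by (simp add: power_divide flip: add_divide_distrib s2)
  then obtain ph where ph: "0 \<le> ph" "ph < 2 * pi" "y $ 1 / s = cos ph" "y $ 2 / s = sin ph"
    by (rule sincos_total_2pi)
  have "ph \<noteq> 0" using ph(4) y2 s0 by auto
  then have ph0: "0 < ph" using ph by simp
  have "y = r *\<^sub>R sph th ph"
    using sinth s0 r0 by (simp add: vec_eq_iff forall_3 th(3) mult.assoc[symmetric] flip: ph(3,4))
  then show ?thesis using that[OF r0 rR th(1,2) ph0 ph(2)] by (simp add: y_def algebra_simps)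
qed

section \<open>Integration over a ball in spherical coordinates\<close>

lemma prod_3: "prod f (UNIV::3 set) = f 1 * f 2 * f 3"
  unfolding UNIV_3 by (simp add: ac_simps)

text \<open>A bridge between two descriptions of space: change of variables is applied in
  \<open>real^3\<close>, iterated integration in nested pairs. The two bijections preserve the
  volume of boxes, hence the scaling factor 1 in \<open>content\<close>.\<close>

lemma has_integral_vec3_prod:
  fixes f :: "real^3 \<Rightarrow> real"
  assumes "(f has_integral i) (cbox (vector [a, b, c]) (vector [a', b', c']))"
  shows "((\<lambda>(x, y, z). f (vector [x, y, z])) has_integral i) (cbox (a, b, c) (a', b', c'))"
proof -
  let ?g = "\<lambda>(x, y, z). vector [x, y, z] :: real^3" and ?h = "\<lambda>v::real^3. (v $ 1, v $ 2, v $ 3)"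
  have hg: "?h (?g x) = x" and gh: "?g (?h v) = v" for x v
    by (auto simp: vec_eq_iff forall_3 split_beta)
  have mem: "?g w \<in> cbox (?g u) (?g v) \<longleftrightarrow> w \<in> cbox u v" for u v w
    by (cases u, cases v, cases w) (simp add: mem_box_cart forall_3 cbox_Pair_eq)
  have g: "?g ` cbox u v = cbox (?g u) (?g v)" for u v
  proof (intro equalityI subsetI)
    fix x assume "x \<in> cbox (?g u) (?g v)"
    then have "?h x \<in> cbox u v" using mem[of "?h x" u v] by (simp only: gh)
    then show "x \<in> ?g ` cbox u v" by (rule image_eqI[where x="?h x", rotated]) (simp only: gh)
  next
    fix x assume "x \<in> ?g ` cbox u v"
    then show "x \<in> cbox (?g u) (?g v)" using mem by blast
  qed
  have h: "?h ` cbox u v = cbox (?h u) (?h v)" for u v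
  proof -
    have "?h ` cbox u v = ?h ` (?g ` cbox (?h u) (?h v))" by (simp only: g gh)
    then show ?thesis by (simp only: image_image hg image_ident)
  qed
  have "continuous_on UNIV (\<lambda>x. ?g x $ i)" for i
    using exhaust_3[of i] by (elim disjE) (auto simp: split_beta intro!: continuous_intros)
  then have cont: "continuous (at x) ?g" for x
    using continuous_on_vec3I[of UNIV ?g] continuous_on_eq_continuous_at[OF open_UNIV] by blast
  have content: "measure lborel (?g ` cbox u v) = 1 * measure lborel (cbox u v)" for u v
  proof (cases "cbox u v = {}")
    case False
    obtain u1 u2 u3 v1 v2 v3 where uv: "u = (u1, u2, u3)" "v = (v1, v2, v3)"
      by (metis prod.exhaust)
    have le: "u1 \<le> v1" "u2 \<le> v2" "u3 \<le> v3"
      using False by (auto simp: uv cbox_Pair_eq)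
    have "cbox (vector [u1, u2, u3]) (vector [v1, v2, v3] :: real^3) \<noteq> {}"
      using le by (simp add: interval_ne_empty_cart forall_3)
    then have "measure lborel (cbox (vector [u1, u2, u3]) (vector [v1, v2, v3] :: real^3))
        = (v1 - u1) * ((v2 - u2) * (v3 - u3))"
      by (subst content_cbox_cart) (simp_all add: prod_3)
    also have "\<dots> = measure lborel (cbox u v)"
      using le by (simp add: uv content_Pair)
    finally show ?thesis
      by (simp only: g) (simp add: uv)
  qed auto
  have "((\<lambda>x. f (?g x)) has_integral (1/1) *\<^sub>R i) (?h ` cbox (vector [a, b, c]) (vector [a', b', c']))"
  proof (rule has_integral_twiddle[OF _ hg gh cont _ _ content assms])
    show "\<exists>w z. ?g ` cbox u v = cbox w z" for u v using g by blast
    show "\<exists>w z. ?h ` cbox u v = cbox w z" for u v using h by blast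
  qed simp
  then show ?thesis by (simp add: h case_prod_unfold)
qed
text \<open>Change of variables is applied on the open box \<open>B\<close>, where the coordinates
  are injective. Passing to the closed box \<open>C\<close> and to the full ball alters both sides
  only on negligible sets.\<close>

lemma has_integral_cball_spherical:
  fixes f :: "real^3 \<Rightarrow> real"
  assumes R: "R > 0" and f: "continuous_on (cball p R) f"
  shows "(f has_integral integral (cbox (0, 0, 0) (R, pi, 2 * pi))
            (\<lambda>(r, th, ph). r\<^sup>2 * sin th * f (p + r *\<^sub>R sph th ph))) (cball p R)"
proof -
  define g :: "real^3 \<Rightarrow> real^3" where "g = (\<lambda>u. p + u $ 1 *\<^sub>R sph (u $ 2) (u $ 3))"
  define F where "F = (\<lambda>u::real^3. (u $ 1)\<^sup>2 * sin (u $ 2) * f (g u))"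
  define B where "B = box (vector [0, 0, 0]) (vector [R, pi, 2 * pi] :: real^3)"
  define C where "C = cbox (vector [0, 0, 0]) (vector [R, pi, 2 * pi] :: real^3)"
  have B: "u \<in> B \<longleftrightarrow> u $ 1 \<in> {0<..<R} \<and> u $ 2 \<in> {0<..<pi} \<and> u $ 3 \<in> {0<..<2*pi}" for u
    by (auto simp: B_def mem_box_cart forall_3)
  have C: "u \<in> C \<longleftrightarrow> u $ 1 \<in> {0..R} \<and> u $ 2 \<in> {0..pi} \<and> u $ 3 \<in> {0..2*pi}" for u
    by (auto simp: C_def mem_box_cart forall_3)
  have g_im: "g u \<in> cball p R" if "u \<in> C" for u
    using that by (auto simp: g_def C dist_norm)
  have g_cont: "continuous_on C g"
    unfolding g_def by (intro continuous_intros)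
  have F_cont: "continuous_on C F"
    unfolding F_def by (intro continuous_intros continuous_on_compose2[OF f g_cont]) (use g_im in auto)
  then have F_abs: "F absolutely_integrable_on C"
    unfolding C_def by (rule absolutely_integrable_continuous)
  define J where "J = integral C F"
  have FJ: "(F has_integral J) C"
    unfolding J_def by (rule integrable_integral) (use F_cont in \<open>auto simp: C_def intro: integrable_continuous\<close>)
  \<comment> \<open>Contains all that the image of the open box can miss: the boundary sphere and
    the plane excluded in \<open>spherical_image\<close>.\<close>
  define N where "N = sphere p R \<union> {x. axis 2 1 \<bullet> x = p $ 2}"
  have N: "negligible N"
    unfolding N_def by (intro negligible_Un negligible_sphere negligible_hyperplane) (simp add: axis_eq_0_iff)
  have bd: "negligible (C - B)"
    using negligible_frontier_interval unfolding C_def B_def .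
  have "B \<subseteq> C" by (auto simp: B C)
  then have FB: "F absolutely_integrable_on B" "(F has_integral J) B"
    using absolutely_integrable_spike_set[OF F_abs, of B] has_integral_spike_set_eq[of C B F J] FJ bd
    by (auto intro: negligible_subset[OF bd])
  define g' where "g' u h = h $ 1 *\<^sub>R sph (u $ 2) (u $ 3) + u $ 1 *\<^sub>R (h $ 2 *\<^sub>R sph_th (u $ 2) (u $ 3)
           + (sin (u $ 2) * h $ 3) *\<^sub>R sph_ph (u $ 3))" for u h :: "real^3"
  have der: "(g has_derivative g' u) (at u within B)" for u
    unfolding g_def g'_def by (rule has_derivative_spherical)
  have inj: "inj_on g B"
    unfolding g_def by (rule inj_on_subset[OF inj_on_spherical]) (auto simp: B)
  have det: "\<bar>det (matrix (g' u))\<bar> = (u $ 1)\<^sup>2 * sin (u $ 2)" if "u \<in> B" for u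
    using that sin_gt_zero[of "u $ 2"] unfolding g'_def by (simp add: det_spherical B)
  \<comment> \<open>The change of variables rule speaks of values in \<open>real^'n\<close>, so the
    real integrand enters as a vector with one component.\<close>
  let ?l = "\<lambda>x. vec (f x) :: real^1"
  have eqF: "vec (F u) = \<bar>det (matrix (g' u))\<bar> *\<^sub>R ?l (g u)" if "u \<in> B" for u
    using det[OF that] by (simp add: vec_eq_iff F_def)
  have lF: "(\<lambda>u. vec (F u) :: real^1) absolutely_integrable_on B" "integral B (\<lambda>u. vec (F u) :: real^1) = vec J"
    using FB by (simp_all add: absolutely_integrable_on_1_iff integral_on_1_eq integral_unique)
  have "(\<lambda>u. \<bar>det (matrix (g' u))\<bar> *\<^sub>R ?l (g u)) absolutely_integrable_on B"
    by (rule absolutely_integrable_spike[OF lF(1) negligible_empty]) (simp add: eqF)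
  moreover have "integral B (\<lambda>u. \<bar>det (matrix (g' u))\<bar> *\<^sub>R ?l (g u)) = vec J"
    using eqF by (simp flip: lF(2) cong: integral_cong)
  moreover have "B \<in> sets lebesgue" by (simp add: B_def)
  ultimately have "?l absolutely_integrable_on (g ` B) \<and> integral (g ` B) ?l = vec J"
    using has_absolute_integral_change_of_variables[OF _ der inj, of ?l "vec J"] by blast
  then have 1: "(f has_integral J) (g ` B)"
    by (auto simp: has_integral_iff integral_on_1_eq integrable_on_1_iff absolutely_integrable_on_def vec_eq_iff)
  have sub: "g ` B \<subseteq> cball p R" using g_im \<open>B \<subseteq> C\<close> by auto
  have "cball p R - g ` B \<subseteq> N"
  proof
    fix x assume x: "x \<in> cball p R - g ` B"
    show "x \<in> N"
    proof (rule ccontr)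
      assume "x \<notin> N"
      then have "x \<in> ball p R" "x $ 2 \<noteq> p $ 2"
        using x by (auto simp: N_def inner_axis' dist_commute)
      then obtain r th ph where "0 < r" "r < R" "0 < th" "th < pi" "0 < ph" "ph < 2 * pi" "x = p + r *\<^sub>R sph th ph"
        by (rule spherical_image)
      then have "x = g (vector [r, th, ph])" "vector [r, th, ph] \<in> B"
        by (auto simp: g_def B)
      with x show False by blast
    qed
  qed
  then have "negligible (cball p R - g ` B)" using N negligible_subset by blast
  then have ng: "negligible {x \<in> cball p R - g ` B. f x \<noteq> 0}"
    by (rule negligible_subset) auto
  have "{x \<in> g ` B - cball p R. f x \<noteq> 0} = {}" using sub by blast
  then have "negligible {x \<in> g ` B - cball p R. f x \<noteq> 0}" by (simp only: negligible_empty)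
  then have 2: "(f has_integral J) (cball p R)"
    using has_integral_spike_set_eq ng 1 by blast
  have "((\<lambda>(r, th, ph). F (vector [r, th, ph])) has_integral J) (cbox (0, 0, 0) (R, pi, 2 * pi))"
    using FJ unfolding C_def by (rule has_integral_vec3_prod)
  moreover have "(\<lambda>(r, th, ph). F (vector [r, th, ph])) = (\<lambda>(r, th, ph). r\<^sup>2 * sin th * f (p + r *\<^sub>R sph th ph))"
    by (auto simp: F_def g_def)
  ultimately show ?thesis using 2 by (simp add: integral_unique)
qed

section \<open>Gauss' theorem on a ball\<close>

text \<open>The trace of a linear map is the same in every orthonormal frame; the \<open>J i\<close>
  are its values on the standard basis, so the right side is a divergence.\<close>

lemma frame_trace:
  fixes J :: "3 \<Rightarrow> real^3"
  defines "L \<equiv> \<lambda>h::real^3. \<Sum>i\<in>UNIV. h $ i *\<^sub>R J i"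
  shows "L (sph th ph) \<bullet> sph th ph + L (sph_th th ph) \<bullet> sph_th th ph + L (sph_ph ph) \<bullet> sph_ph ph
           = (\<Sum>i\<in>UNIV. J i $ i)"
proof -
  have *: "(sin th)\<^sup>2 + (cos th)\<^sup>2 = 1" "(sin ph)\<^sup>2 + (cos ph)\<^sup>2 = 1"
    by auto
  show ?thesis
    unfolding L_def inner_real3 sum_3
    by simp (use * in algebra)
qed

lemma has_real_derivative_along:
  fixes W :: "real^3 \<Rightarrow> real^3"
  assumes W: "\<And>x. x \<in> B \<Longrightarrow> (W has_derivative W' x) (at x within B)"
    and g: "(g has_vector_derivative g') (at t within S)" "g ` S \<subseteq> B" "t \<in> S"
  shows "((\<lambda>t. W (g t) $ i) has_real_derivative W' (g t) g' $ i) (at t within S)"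
proof -
  have "((\<lambda>t. W (g t)) has_derivative (\<lambda>y. W' (g t) (y *\<^sub>R g'))) (at t within S)"
    using has_derivative_in_compose2[OF W g(2,3)] g(1) by (simp add: has_vector_derivative_def)
  moreover have "bounded_linear (W' (g t))"
    using W[of "g t"] g by (auto dest: has_derivative_bounded_linear)
  ultimately have "((\<lambda>t. W (g t)) has_derivative (\<lambda>y. y *\<^sub>R W' (g t) g')) (at t within S)"
    by (simp add: linear_simps)
  then have "((\<lambda>t. W (g t) $ i) has_derivative (\<lambda>y. (y *\<^sub>R W' (g t) g') $ i)) (at t within S)"
    by (rule bounded_linear.has_derivative[OF bounded_linear_vec_nth])
  then show ?thesis by (simp add: has_field_derivative_def mult_commute_abs)
qed

lemma continuous_on_sph_th [continuous_intros]:
  fixes f :: "'a::t2_space \<Rightarrow> real"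
  assumes "continuous_on S f" "continuous_on S g"
  shows "continuous_on S (\<lambda>x. sph_th (f x) (g x))"
proof (rule continuous_on_vec3I)
  fix i :: 3
  show "continuous_on S (\<lambda>x. sph_th (f x) (g x) $ i)"
    using exhaust_3[of i]
    by (elim disjE) (auto intro!: continuous_on_mult continuous_on_minus continuous_on_sin continuous_on_cos assms)
qed

lemma continuous_on_sph_ph [continuous_intros]:
  fixes f :: "'a::t2_space \<Rightarrow> real"
  assumes "continuous_on S f"
  shows "continuous_on S (\<lambda>x. sph_ph (f x))"
proof (rule continuous_on_vec3I)
  fix i :: 3
  show "continuous_on S (\<lambda>x. sph_ph (f x) $ i)"
    using exhaust_3[of i] by (elim disjE) (auto intro!: continuous_on_minus continuous_on_sin continuous_on_cos assms)
qed

text \<open>In spherical coordinates the divergence times the Jacobian is a sum of one pure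
  derivative in each coordinate, and each is integrated first in its own variable. The azimuthal
  part vanishes by periodicity, the polar part because sin vanishes at 0 and pi, and the radial part
  leaves the value at r = R, since its weight r^2 vanishes at the centre.\<close>

lemma gauss_cball:
  fixes W :: "real^3 \<Rightarrow> real^3"
  assumes R: "R > 0"
    and W: "\<And>x. x \<in> cball p R \<Longrightarrow> (W has_derivative W' x) (at x within cball p R)"
    and cont: "\<And>h. continuous_on (cball p R) (\<lambda>x. W' x h)"
  shows "integral (cball p R) (\<lambda>x. \<Sum>i\<in>UNIV. W' x (axis i 1) $ i)
           = sphere_integral p R (\<lambda>x. W x \<bullet> ((x - p) /\<^sub>R R))"
proof -
  let ?K = "cbox (0, 0, 0) (R, pi, 2 * pi)"
  define X where "X r th ph = p + r *\<^sub>R sph th ph" for r th ph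
  have X: "X r th ph \<in> cball p R" if "r \<in> {0..R}" for r th ph
    using that by (simp add: X_def dist_norm)
  define J where "J i x = W' x (axis i 1)" for i x
  have lin: "W' x h = (\<Sum>i\<in>UNIV. h $ i *\<^sub>R J i x)" if "x \<in> cball p R" for x h
  proof -
    have "linear (W' x)"
      using W[OF that] has_derivative_bounded_linear bounded_linear.linear by blast
    then have "W' x (\<Sum>i\<in>UNIV. h $ i *\<^sub>R axis i 1) = (\<Sum>i\<in>UNIV. h $ i *\<^sub>R W' x (axis i 1))"
      by (simp add: linear_sum linear_scale)
    then show ?thesis by (simp add: J_def basis_expansion scalar_mult_eq_scaleR[symmetric])
  qed
  define L where "L x h = (\<Sum>i\<in>UNIV. h $ i *\<^sub>R J i x)" for x h
  have along: "((\<lambda>t. W (g t) $ i) has_real_derivative L (g t) g' $ i) (at t within S)"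
    if "(g has_vector_derivative g') (at t within S)" "g ` S \<subseteq> cball p R" "t \<in> S" for g g' t S i
    using has_real_derivative_along[OF W that(1,2,3), of i] lin[of "g t"] that(2,3) by (auto simp: L_def)
  \<comment> \<open>\<open>A\<close>, \<open>B\<close>, \<open>C\<close> are the derivatives in r,
    th, ph of the radial, polar and azimuthal components of \<open>W\<close> with weights r^2 sin
    th, r sin th and r.\<close>
  define A where "A r th ph = 2 * r * sin th * (W (X r th ph) \<bullet> sph th ph)
       + r\<^sup>2 * sin th * (L (X r th ph) (sph th ph) \<bullet> sph th ph)" for r th ph
  define B where "B r th ph = r * cos th * (W (X r th ph) \<bullet> sph_th th ph)
       + r * sin th * (r * (L (X r th ph) (sph_th th ph) \<bullet> sph_th th ph) - W (X r th ph) \<bullet> sph th ph)" for r th ph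
  define C where "C r th ph = r * (r * sin th * (L (X r th ph) (sph_ph ph) \<bullet> sph_ph ph)
       - W (X r th ph) \<bullet> (sin th *\<^sub>R sph th ph + cos th *\<^sub>R sph_th th ph))" for r th ph
  \<comment> \<open>The terms with undifferentiated \<open>W\<close> cancel: the weight r^2
    contributes 2 and the turning of the frame -1 for each angle, while the polar components in
    \<open>B\<close> and \<open>C\<close> are opposite.\<close>
  have sum: "A r th ph + B r th ph + C r th ph = r\<^sup>2 * sin th * (\<Sum>i\<in>UNIV. W' (X r th ph) (axis i 1) $ i)" for r th ph
  proof -
    have "A r th ph + B r th ph + C r th ph = r\<^sup>2 * sin th * (L (X r th ph) (sph th ph) \<bullet> sph th ph
       + L (X r th ph) (sph_th th ph) \<bullet> sph_th th ph + L (X r th ph) (sph_ph ph) \<bullet> sph_ph ph)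
       + r * sin th * (W (X r th ph) \<bullet> sph th ph) * (2 - 1 - 1)"
      unfolding A_def B_def C_def inner_add_right inner_scaleR_right by algebra
    then show ?thesis unfolding L_def frame_trace J_def by simp
  qed
  have dr: "((\<lambda>r. r\<^sup>2 * sin th * (W (X r th ph) \<bullet> sph th ph)) has_real_derivative A r th ph) (at r within {0..R})"
    if r: "r \<in> {0..R}" for r th ph
  proof -
    have "((\<lambda>r. X r th ph) has_vector_derivative sph th ph) (at r within {0..R})"
      unfolding X_def by (auto intro!: derivative_eq_intros simp: has_vector_derivative_def)
    note d = along[OF this _ r]
    show ?thesis unfolding inner_real3 A_def
      by (rule derivative_eq_intros d refl | use X in force | simp add: field_simps power2_eq_square)+
  qed
  have dth: "((\<lambda>th. r * sin th * (W (X r th ph) \<bullet> sph_th th ph)) has_real_derivative B r th ph) (at th within {0..pi})"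
    if r: "r \<in> {0..R}" and th: "th \<in> {0..pi}" for r th ph
  proof -
    have "((\<lambda>th. X r th ph) has_vector_derivative r *\<^sub>R sph_th th ph) (at th within {0..pi})"
      unfolding X_def has_vector_derivative_def
      by (rule derivative_eq_intros has_derivative_sph refl | simp add: mult.commute mult.left_commute)+
    note d = along[OF this _ th]
    have *: "L x (r *\<^sub>R h) $ i = r * L x h $ i" for x h i
      by (simp add: L_def sum_distrib_left algebra_simps)
    show ?thesis unfolding inner_real3 B_def sph_frame_nth sph_nth
      by (rule derivative_eq_intros d[unfolded *] refl | use X r in force)+ (simp add: field_simps power2_eq_square)
  qed
  have dph: "((\<lambda>ph. r * (W (X r th ph) \<bullet> sph_ph ph)) has_real_derivative C r th ph) (at ph within {0..2*pi})"
    if r: "r \<in> {0..R}" and ph: "ph \<in> {0..2*pi}" for r th ph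
  proof -
    have "((\<lambda>ph. X r th ph) has_vector_derivative (r * sin th) *\<^sub>R sph_ph ph) (at ph within {0..2*pi})"
      unfolding X_def has_vector_derivative_def
      by (rule derivative_eq_intros has_derivative_sph refl | simp add: mult.commute mult.left_commute)+
    note d = along[OF this _ ph]
    have *: "L x (r *\<^sub>R h) $ i = r * L x h $ i" for x h i r
      by (simp add: L_def sum_distrib_left algebra_simps)
    have **: "(sin th)\<^sup>2 + (cos th)\<^sup>2 = 1" by simp
    show ?thesis unfolding inner_real3 C_def sph_frame_nth sph_nth
      by (rule derivative_eq_intros d[unfolded *] refl | use X r in force)+ (simp, use ** in algebra)
  qed
  have Wc: "continuous_on (cball p R) W"
    using W has_derivative_continuous continuous_on_eq_continuous_within by blast
  have Jc: "continuous_on (cball p R) (J i)" for i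
    unfolding J_def by (rule cont)
  have Xc: "continuous_on ?K (\<lambda>(r, th, ph). X r th ph)"
    unfolding X_def case_prod_unfold by (intro continuous_intros)
  have Xim: "(\<lambda>(r, th, ph). X r th ph) ` ?K \<subseteq> cball p R"
    using X by (auto simp: cbox_Pair_eq)
  note c = continuous_on_compose2[OF Wc Xc Xim] continuous_on_compose2[OF Jc Xc Xim]
  have Pc: "continuous_on (cbox (0, 0) (pi, 2*pi)) (\<lambda>z. (r, z))" "(\<lambda>z. (r, z)) ` cbox (0, 0) (pi, 2*pi) \<subseteq> ?K"
    if "r \<in> cbox 0 R" for r
    using that by (auto simp: cbox_Pair_eq intro!: continuous_on_Pair continuous_on_id)
  have cA: "continuous_on ?K (\<lambda>(r, th, ph). A r th ph)"
    and cB: "continuous_on ?K (\<lambda>(r, th, ph). B r th ph)"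
    and cC: "continuous_on ?K (\<lambda>(r, th, ph). C r th ph)"
    unfolding A_def B_def C_def L_def case_prod_unfold
    by (intro continuous_intros c[unfolded case_prod_unfold])+
  have canc: "inverse R * (R * y) = y" for y
    using R by simp
  have "integral (cball p R) (\<lambda>x. \<Sum>i\<in>UNIV. W' x (axis i 1) $ i)
     = integral ?K (\<lambda>(r, th, ph). r\<^sup>2 * sin th * (\<Sum>i\<in>UNIV. W' (X r th ph) (axis i 1) $ i))"
    unfolding X_def by (intro integral_unique has_integral_cball_spherical R continuous_intros cont)
  also have "\<dots> = integral ?K (\<lambda>z. (case z of (r, th, ph) \<Rightarrow> A r th ph) + (case z of (r, th, ph) \<Rightarrow> B r th ph)
       + (case z of (r, th, ph) \<Rightarrow> C r th ph))"
    by (simp only: case_prod_unfold sum)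
  also have "\<dots> = integral ?K (\<lambda>(r, th, ph). A r th ph) + integral ?K (\<lambda>(r, th, ph). B r th ph)
       + integral ?K (\<lambda>(r, th, ph). C r th ph)"
    using cA cB cC by (simp add: integral_add integrable_add integrable_continuous)
  also have "integral ?K (\<lambda>(r, th, ph). C r th ph) = 0"
  proof -
    have in0: "integral (cbox 0 (2*pi)) (\<lambda>ph. C r th ph) = 0" if "r \<in> {0..R}" for r th
    proof -
      have "((\<lambda>ph. C r th ph) has_integral r * (W (X r th (2*pi)) \<bullet> sph_ph (2*pi)) - r * (W (X r th 0) \<bullet> sph_ph 0)) {0..2*pi}"
        by (rule fundamental_theorem_of_calculus) (use dph[OF that] in \<open>auto simp: has_real_derivative_iff_has_vector_derivative[symmetric]\<close>)
      moreover have "sph_ph (2*pi) = sph_ph 0" "sph th (2*pi) = sph th 0"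
        by (simp_all add: sph_def sph_ph_def)
      ultimately show ?thesis by (auto simp: X_def intro: integral_unique)
    qed
    have "integral ?K (\<lambda>(r, th, ph). C r th ph) = integral (cbox 0 R) (\<lambda>r. integral (cbox (0, 0) (pi, 2*pi)) (\<lambda>(th, ph). C r th ph))"
      using integral_prod_continuous[OF cC] by simp
    also have "\<dots> = integral (cbox 0 R) (\<lambda>r. 0)"
    proof (rule integral_cong)
      fix r assume r: "r \<in> cbox 0 R"
      have "continuous_on (cbox (0, 0) (pi, 2*pi)) (\<lambda>(th, ph). C r th ph)"
        using continuous_on_compose2[OF cC Pc[OF r]] by simp
      from integral_prod_continuous[OF this]
      show "integral (cbox (0, 0) (pi, 2*pi)) (\<lambda>(th, ph). C r th ph) = 0"
        using in0 r by simp
    qed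
    finally show ?thesis by simp
  qed
  also have "integral ?K (\<lambda>(r, th, ph). B r th ph) = 0"
  proof -
    have in0: "integral (cbox 0 pi) (\<lambda>th. B r th ph) = 0" if "r \<in> {0..R}" for r ph
    proof -
      have "((\<lambda>th. B r th ph) has_integral r * sin pi * (W (X r pi ph) \<bullet> sph_th pi ph)
          - r * sin 0 * (W (X r 0 ph) \<bullet> sph_th 0 ph)) {0..pi}"
        by (rule fundamental_theorem_of_calculus) (use dth[OF that] in \<open>auto simp: has_real_derivative_iff_has_vector_derivative[symmetric]\<close>)
      then show ?thesis by (auto intro: integral_unique)
    qed
    have "integral ?K (\<lambda>(r, th, ph). B r th ph) = integral (cbox 0 R) (\<lambda>r. integral (cbox (0, 0) (pi, 2*pi)) (\<lambda>(th, ph). B r th ph))"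
      using integral_prod_continuous[OF cB] by simp
    also have "\<dots> = integral (cbox 0 R) (\<lambda>r. 0)"
    proof (rule integral_cong)
      fix r assume r: "r \<in> cbox 0 R"
      have cc: "continuous_on (cbox (0, 0) (pi, 2*pi)) (\<lambda>(th, ph). B r th ph)"
        using continuous_on_compose2[OF cB Pc[OF r]] by simp
      from integral_prod_continuous[OF this] integral_swap_continuous[OF cc]
      show "integral (cbox (0, 0) (pi, 2*pi)) (\<lambda>(th, ph). B r th ph) = 0"
        using in0 r by simp
    qed
    finally show ?thesis by simp
  qed
  also have "integral ?K (\<lambda>(r, th, ph). A r th ph)
      = integral (cbox (0, 0) (pi, 2*pi)) (\<lambda>(th, ph). R\<^sup>2 * sin th * (W (X R th ph) \<bullet> sph th ph))"
  proof -
    have in0: "integral (cbox 0 R) (\<lambda>r. A r th ph) = R\<^sup>2 * sin th * (W (X R th ph) \<bullet> sph th ph)" for th ph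
    proof -
      have "((\<lambda>r. A r th ph) has_integral R\<^sup>2 * sin th * (W (X R th ph) \<bullet> sph th ph)
          - 0\<^sup>2 * sin th * (W (X 0 th ph) \<bullet> sph th ph)) {0..R}"
        by (rule fundamental_theorem_of_calculus) (use R dr in \<open>auto simp: has_real_derivative_iff_has_vector_derivative[symmetric]\<close>)
      then show ?thesis by (auto intro: integral_unique)
    qed
    have cA': "continuous_on ?K (\<lambda>(r, z). A r (fst z) (snd z))"
      using cA by (simp add: case_prod_unfold)
    have "integral ?K (\<lambda>(r, th, ph). A r th ph) = integral (cbox 0 R) (\<lambda>r. integral (cbox (0, 0) (pi, 2*pi)) (\<lambda>z. A r (fst z) (snd z)))"
      using integral_prod_continuous[OF cA'] by (simp add: case_prod_unfold)
    also have "\<dots> = integral (cbox (0, 0) (pi, 2*pi)) (\<lambda>z. integral (cbox 0 R) (\<lambda>r. A r (fst z) (snd z)))"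
      by (rule integral_swap_continuous[OF cA'])
    finally show ?thesis by (simp only: in0 case_prod_unfold)
  qed
  finally show ?thesis
    using R by (simp add: canc sphere_integral_def X_def cbox_Pair_eq case_prod_unfold mult.assoc flip: integral_mult_right)
qed

section \<open>Calculus on a tube around a trajectory\<close>

text \<open>Continuity of the derivative is asked for each fixed direction h only. This lets the
  derivative be an explicit formula assembled term by term; when a direction varies with the point,
  it has to be expanded in a basis.\<close>

definition C1_on :: "('a::real_normed_vector \<Rightarrow> 'b::real_normed_vector) \<Rightarrow> ('a \<Rightarrow> 'a \<Rightarrow> 'b) \<Rightarrow> 'a set \<Rightarrow> bool" where
  "C1_on f f' S \<longleftrightarrow> (\<forall>z\<in>S. (f has_derivative f' z) (at z within S)) \<and> (\<forall>h. continuous_on S (\<lambda>z. f' z h))"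

lemma C1_onI:
  assumes "\<And>z. z \<in> S \<Longrightarrow> (f has_derivative f' z) (at z within S)" "\<And>h. continuous_on S (\<lambda>z. f' z h)"
  shows "C1_on f f' S"
  using assms by (simp add: C1_on_def)

lemma C1_onD:
  assumes "C1_on f f' S"
  shows "z \<in> S \<Longrightarrow> (f has_derivative f' z) (at z within S)" "continuous_on S (\<lambda>z. f' z h)" "continuous_on S f"
  using assms by (auto simp: C1_on_def continuous_on_eq_continuous_within intro: has_derivative_continuous)

text \<open>At a boundary point not all directions are available, but by convexity the segment from
  x to every y of the ball is. It fixes the derivative on y - x, and differences of such vectors
  fill the space.\<close>

lemma has_derivative_unique_cball:
  fixes f :: "'a::real_normed_vector \<Rightarrow> 'b::real_normed_vector"
  assumes R: "R > 0" and x: "x \<in> cball p R"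
    and f1: "(f has_derivative f1) (at x within cball p R)"
    and f2: "(f has_derivative f2) (at x within cball p R)"
  shows "f1 = f2"
proof
  interpret f1: bounded_linear f1 using f1 by (rule has_derivative_bounded_linear)
  interpret f2: bounded_linear f2 using f2 by (rule has_derivative_bounded_linear)
  have seg: "f1 (y - x) = f2 (y - x)" if y: "y \<in> cball p R" for y
  proof -
    have im: "(\<lambda>s. x + s *\<^sub>R (y - x)) ` {0..1} \<subseteq> cball p R"
    proof clarsimp
      fix s :: real assume s: "0 \<le> s" "s \<le> 1"
      have "(1 - s) *\<^sub>R x + s *\<^sub>R y \<in> cball p R"
        using convexD_alt[OF convex_cball x y s] .
      then show "dist p (x + s *\<^sub>R (y - x)) \<le> R" by (simp add: algebra_simps)
    qed
    have d: "((\<lambda>s. x + s *\<^sub>R (y - x)) has_derivative (\<lambda>s. s *\<^sub>R (y - x))) (at 0 within {0..1})"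
      by (auto intro!: derivative_eq_intros)
    have "((\<lambda>s. f (x + s *\<^sub>R (y - x))) has_vector_derivative f' (y - x)) (at 0 within {0..1})"
      if f': "(f has_derivative f') (at x within cball p R)" for f'
    proof -
      have "((\<lambda>s. f (x + s *\<^sub>R (y - x))) has_derivative (\<lambda>s. f' (s *\<^sub>R (y - x)))) (at 0 within {0..1})"
        using has_derivative_in_compose[OF d, of f f'] has_derivative_subset[OF f' im] by simp
      then show ?thesis
        using has_derivative_bounded_linear[OF f'] by (simp add: has_vector_derivative_def linear_simps)
    qed
    from this[OF f1] this[OF f2] show ?thesis
      using vector_derivative_unique_within_closed_interval[of 0 1 0] by auto
  qed
  fix h show "f1 h = f2 h"
  proof (cases "h = 0")
    case False
    \<comment> \<open>Both y and the centre p lie in the ball, and (y - x) - (p - x) is a positive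
      multiple of h.\<close>
    define y where "y = p + (R / norm h) *\<^sub>R h"
    have y: "y \<in> cball p R" using R False by (simp add: y_def dist_norm)
    have "f1 (y - x) - f1 (p - x) = f2 (y - x) - f2 (p - x)"
      using seg[OF y] seg[of p] R by simp
    then have "f1 (y - p) = f2 (y - p)"
      by (simp flip: f1.diff f2.diff)
    then have "(R / norm h) *\<^sub>R f1 h = (R / norm h) *\<^sub>R f2 h"
      by (simp add: y_def f1.scaleR f2.scaleR)
    then show ?thesis using R False by simp
  qed (simp add: f1.zero f2.zero)
qed

text \<open>The second difference over a small parallelogram is, by the mean value theorem taken in either order,
  a nearby value of either mixed derivative.\<close>

lemma second_derivative_symmetric_real:
  fixes f :: "'a::real_normed_vector \<Rightarrow> real"
  assumes U: "open U" "z \<in> U"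
    and f: "\<And>z. z \<in> U \<Longrightarrow> (f has_derivative f1 z) (at z)"
    and f1: "\<And>z k. z \<in> U \<Longrightarrow> ((\<lambda>z. f1 z k) has_derivative (\<lambda>h. f2 z h k)) (at z)"
    and f2: "\<And>h k. continuous_on U (\<lambda>z. f2 z h k)"
  shows "f2 z h k = f2 z k h"
proof -
  have lin: "bounded_linear (f1 z)" "bounded_linear (\<lambda>h. f2 z h k)" if "z \<in> U" for z k
    using f[OF that] f1[OF that] has_derivative_bounded_linear by auto
  have line: "((\<lambda>s. g (w + s *\<^sub>R h)) has_real_derivative g' (w + s *\<^sub>R h) h) (at s)"
    if "w + s *\<^sub>R h \<in> U" and g: "\<And>z. z \<in> U \<Longrightarrow> (g has_derivative g' z) (at z)"
    for g :: "'a \<Rightarrow> real" and g' w s h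
  proof -
    have d: "((\<lambda>s. w + s *\<^sub>R h) has_derivative (\<lambda>t. t *\<^sub>R h)) (at s)"
      by (auto intro!: derivative_eq_intros)
    from has_derivative_compose[OF d g[OF that(1)]] 
    have "((\<lambda>s. g (w + s *\<^sub>R h)) has_derivative (\<lambda>t. g' (w + s *\<^sub>R h) (t *\<^sub>R h))) (at s)" .
    then show ?thesis
      using has_derivative_bounded_linear[OF g[OF that(1)]]
      by (simp add: has_field_derivative_def linear_simps mult_commute_abs)
  qed
  have mixed: "\<exists>a b. a \<in> {0..e} \<and> b \<in> {0..e} \<and>
      f (z + e *\<^sub>R h + e *\<^sub>R k) - f (z + e *\<^sub>R h) - f (z + e *\<^sub>R k) + f z = e\<^sup>2 * f2 (z + a *\<^sub>R h + b *\<^sub>R k) k h"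
    if e: "e > 0" and sq: "\<And>a b. a \<in> {0..e} \<Longrightarrow> b \<in> {0..e} \<Longrightarrow> z + a *\<^sub>R h + b *\<^sub>R k \<in> U" for e h k
  proof -
    let ?g = "\<lambda>s. f ((z + e *\<^sub>R k) + s *\<^sub>R h) - f (z + s *\<^sub>R h)"
    have "(?g has_real_derivative f1 (z + e *\<^sub>R k + s *\<^sub>R h) h - f1 (z + s *\<^sub>R h) h) (at s)" if "0 \<le> s" "s \<le> e" for s
      using sq[of s e] sq[of s 0] that e
      by (intro DERIV_diff line f) (auto simp: algebra_simps)
    from MVT2[OF e this] obtain a where a: "0 < a" "a < e"
      and ga: "?g e - ?g 0 = (e - 0) * (f1 (z + e *\<^sub>R k + a *\<^sub>R h) h - f1 (z + a *\<^sub>R h) h)" by blast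
    have "((\<lambda>s. f1 (z + a *\<^sub>R h + s *\<^sub>R k) h) has_real_derivative f2 (z + a *\<^sub>R h + s *\<^sub>R k) k h) (at s)"
      if "0 \<le> s" "s \<le> e" for s
      using sq[of a s] that a by (intro line[where g = "\<lambda>z. f1 z h" and g' = "\<lambda>z k. f2 z k h"] f1) auto
    from MVT2[OF e this] obtain b where b: "0 < b" "b < e"
      and gb: "f1 (z + a *\<^sub>R h + e *\<^sub>R k) h - f1 (z + a *\<^sub>R h + 0 *\<^sub>R k) h = (e - 0) * f2 (z + a *\<^sub>R h + b *\<^sub>R k) k h"
      by blast
    have "?g e - ?g 0 = e\<^sup>2 * f2 (z + a *\<^sub>R h + b *\<^sub>R k) k h"
      using ga gb by (simp add: power2_eq_square algebra_simps)
    then show ?thesis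
      using a b by (intro exI[of _ a] exI[of _ b]) (auto simp: algebra_simps)
  qed
  show ?thesis
  proof (rule ccontr)
    assume ne: "f2 z h k \<noteq> f2 z k h"
    \<comment> \<open>Half the gap: one number cannot be closer than d to both mixed
      derivatives.\<close>
    define d where "d = \<bar>f2 z h k - f2 z k h\<bar> / 2"
    have d: "d > 0" using ne by (simp add: d_def)
    have "\<forall>\<^sub>F w in nhds z. w \<in> U \<and> \<bar>f2 w h k - f2 z h k\<bar> < d \<and> \<bar>f2 w k h - f2 z k h\<bar> < d"
    proof -
      have "isCont (\<lambda>w. f2 w h k) z" "isCont (\<lambda>w. f2 w k h) z"
        using f2 U continuous_on_eq_continuous_at by blast+
      then have "\<forall>\<^sub>F w in nhds z. dist (f2 w h k) (f2 z h k) < d" "\<forall>\<^sub>F w in nhds z. dist (f2 w k h) (f2 z k h) < d"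
        using d tendsto_at_iff_tendsto_nhds[of "\<lambda>w. f2 w h k" z] tendsto_at_iff_tendsto_nhds[of "\<lambda>w. f2 w k h" z]
        by (auto simp: isCont_def intro: tendstoD)
      moreover have "\<forall>\<^sub>F w in nhds z. w \<in> U" using U eventually_nhds_in_open by blast
      ultimately show ?thesis by eventually_elim (auto simp: dist_real_def)
    qed
    then obtain r where r: "r > 0" and near: "\<And>w. dist w z < r \<Longrightarrow> w \<in> U \<and> \<bar>f2 w h k - f2 z h k\<bar> < d \<and> \<bar>f2 w k h - f2 z k h\<bar> < d"
      unfolding eventually_nhds_metric by blast
    define e where "e = r / (2 * (norm h + norm k + 1))"
    have nn: "norm h + norm k + 1 > 0" by (simp add: add_nonneg_pos)
    have e: "e > 0" using r nn by (simp add: e_def)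
    have close: "dist (z + a *\<^sub>R h + b *\<^sub>R k) z < r" if "a \<in> {0..e}" "b \<in> {0..e}" for a b
    proof -
      have "norm (a *\<^sub>R h + b *\<^sub>R k) \<le> a * norm h + b * norm k"
        using that norm_triangle_ineq[of "a *\<^sub>R h" "b *\<^sub>R k"] by simp
      also have "\<dots> \<le> e * norm h + e * norm k"
        using that by (intro add_mono mult_right_mono) auto
      also have "\<dots> \<le> e * (norm h + norm k + 1)" using e by (simp add: algebra_simps)
      also have "\<dots> = r / 2" using nn unfolding e_def by (simp add: field_simps)
      also have "\<dots> < r" using r by simp
      finally show ?thesis by (simp add: dist_norm algebra_simps)
    qed
    obtain a b where ab: "a \<in> {0..e}" "b \<in> {0..e}"
      "f (z + e *\<^sub>R h + e *\<^sub>R k) - f (z + e *\<^sub>R h) - f (z + e *\<^sub>R k) + f z = e\<^sup>2 * f2 (z + a *\<^sub>R h + b *\<^sub>R k) k h"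
      using mixed[OF e, of h k] near close by meson
    have close': "dist (z + a *\<^sub>R k + b *\<^sub>R h) z < r" if "a \<in> {0..e}" "b \<in> {0..e}" for a b
      using close[OF that(2,1)] by (simp add: add_ac)
    obtain a' b' where ab': "a' \<in> {0..e}" "b' \<in> {0..e}"
      "f (z + e *\<^sub>R k + e *\<^sub>R h) - f (z + e *\<^sub>R k) - f (z + e *\<^sub>R h) + f z = e\<^sup>2 * f2 (z + a' *\<^sub>R k + b' *\<^sub>R h) h k"
      using mixed[OF e, of k h] near close' by meson
    have "e\<^sup>2 * f2 (z + a *\<^sub>R h + b *\<^sub>R k) k h = e\<^sup>2 * f2 (z + a' *\<^sub>R k + b' *\<^sub>R h) h k"
      using ab(3) ab'(3) unfolding add.assoc[of z] add.commute[of "e *\<^sub>R k" "e *\<^sub>R h"] by linarith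
    then have "f2 (z + a *\<^sub>R h + b *\<^sub>R k) k h = f2 (z + a' *\<^sub>R k + b' *\<^sub>R h) h k"
      using e by simp
    moreover have "\<bar>f2 (z + a *\<^sub>R h + b *\<^sub>R k) k h - f2 z k h\<bar> < d"
      using near[OF close[OF ab(1,2)]] by blast
    moreover have "\<bar>f2 (z + a' *\<^sub>R k + b' *\<^sub>R h) h k - f2 z h k\<bar> < d"
      using near[OF close'[OF ab'(1,2)]] by blast
    ultimately show False unfolding d_def by (smt (verit) field_sum_of_halves)
  qed
qed

locale tube =
  fixes Tm Tp R :: real and rhat v :: "real \<Rightarrow> real^3"
  assumes T: "Tm < Tp" and R: "R > 0"
    and rhat: "\<And>t. t \<in> {Tm..Tp} \<Longrightarrow> (rhat has_vector_derivative v t) (at t within {Tm..Tp})"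
    and v: "continuous_on {Tm..Tp} v"
begin

abbreviation I where "I \<equiv> {Tm..Tp}"
abbreviation S where "S \<equiv> OmegaHat Tm Tp rhat R"
abbreviation ball_at where "ball_at t \<equiv> cball (rhat t) R"

lemma mem_S: "(t, x) \<in> S \<longleftrightarrow> t \<in> I \<and> x \<in> ball_at t"
  by (simp add: OmegaHat_def)

lemma continuous_rhat: "continuous_on I rhat"
  using rhat has_vector_derivative_continuous continuous_on_eq_continuous_within by blast

lemma slice_derivative:
  assumes f: "(f has_derivative f') (at (t, x) within S)" and z: "(t, x) \<in> S"
  shows "((\<lambda>y. f (t, y)) has_derivative (\<lambda>h. f' (0, h))) (at x within ball_at t)"
proof -
  have d: "((\<lambda>y. (t, y)) has_derivative (\<lambda>h. (0, h))) (at x within ball_at t)"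
    by (auto intro!: derivative_eq_intros)
  show ?thesis
    by (rule has_derivative_in_compose[OF d]) (rule has_derivative_subset[OF f], use z mem_S in auto)
qed

text \<open>With the offset y from the centre held fixed, the curve stays in the tube for all times
  of \<open>I\<close>. Hence the material derivative, in direction \<open>(1, v t)\<close>, makes
  sense even at lateral boundary points, where the direction \<open>(1, 0)\<close> may leave the
  tube.\<close>

lemma moving_derivative:
  assumes f: "(f has_derivative f') (at (t, rhat t + y) within S)" and t: "t \<in> I" and y: "norm y \<le> R"
  shows "((\<lambda>s. f (s, rhat s + y)) has_vector_derivative f' (1, v t)) (at t within I)"
proof -
  have d: "((\<lambda>s. (s, rhat s + y)) has_derivative (\<lambda>h. (h, h *\<^sub>R v t))) (at t within I)"
    using rhat[OF t, unfolded has_vector_derivative_def] by (auto intro!: derivative_eq_intros)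
  have im: "(\<lambda>s. (s, rhat s + y)) ` I \<subseteq> S"
    using y by (auto simp: mem_S dist_norm)
  have "((\<lambda>s. f (s, rhat s + y)) has_derivative (\<lambda>h. f' (h, h *\<^sub>R v t))) (at t within I)"
    by (rule has_derivative_in_compose[OF d has_derivative_subset[OF f im]])
  moreover have "f' (h, h *\<^sub>R v t) = h *\<^sub>R f' (1, v t)" for h
    using linear_simps(5)[OF has_derivative_bounded_linear[OF f], of h "(1, v t)"] by simp
  ultimately show ?thesis by (simp add: has_vector_derivative_def)
qed

text \<open>At a boundary point the tube need not contain a segment in each coordinate direction, so uniqueness is
  obtained from the spatial slices and from the curves that follow the trajectory.\<close>

lemma derivative_unique:
  assumes z: "z \<in> S" and f1: "(f has_derivative f1) (at z within S)" and f2: "(f has_derivative f2) (at z within S)"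
  shows "f1 = f2"
proof -
  interpret f1: bounded_linear f1 using f1 by (rule has_derivative_bounded_linear)
  interpret f2: bounded_linear f2 using f2 by (rule has_derivative_bounded_linear)
  obtain t x where tx: "z = (t, x)" by (cases z)
  have t: "t \<in> I" and x: "x \<in> ball_at t" using z tx mem_S by auto
  have "(\<lambda>h. f1 (0, h)) = (\<lambda>h. f2 (0, h))"
    using has_derivative_unique_cball[OF R x] slice_derivative f1 f2 z unfolding tx by metis
  then have sp: "f1 (0, h) = f2 (0, h)" for h by metis
  have "((\<lambda>s. f (s, rhat s + (x - rhat t))) has_vector_derivative f1 (1, v t)) (at t within I)"
       "((\<lambda>s. f (s, rhat s + (x - rhat t))) has_vector_derivative f2 (1, v t)) (at t within I)"
    using f1 f2 x t by (auto intro!: moving_derivative simp: tx dist_norm norm_minus_commute)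
  then have tm: "f1 (1, v t) = f2 (1, v t)"
    using vector_derivative_unique_within_closed_interval[OF T] t by auto
  show ?thesis
  proof
    fix h :: st
    have h: "h = fst h *\<^sub>R (1, v t) + (0, snd h - fst h *\<^sub>R v t)" by (cases h) simp
    show "f1 h = f2 h" by (subst (1 2) h) (simp only: f1.add f2.add f1.scaleR f2.scaleR sp tm)
  qed
qed

lemma frechet_derivative_eq:
  assumes "z \<in> S" "(f has_derivative f') (at z within S)"
  shows "frechet_derivative f (at z within S) = f'"
  using assms derivative_unique frechet_derivative_works differentiableI by blast

text \<open>In the interior the real case is applied to inner products with fixed vectors. The
  boundary is reached by continuity along a curve that enters the interior at once.\<close>

lemma second_derivative_symmetric:
  fixes f :: "st \<Rightarrow> 'b::real_inner"
  assumes f: "\<And>z. z \<in> S \<Longrightarrow> (f has_derivative f1 z) (at z within S)"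
    and f1: "\<And>z k. z \<in> S \<Longrightarrow> ((\<lambda>z. f1 z k) has_derivative (\<lambda>h. f2 z h k)) (at z within S)"
    and f2: "\<And>h k. continuous_on S (\<lambda>z. f2 z h k)"
    and z: "z \<in> S"
  shows "f2 z h k = f2 z k h"
proof -
  define U where "U = {z. fst z \<in> {Tm<..<Tp} \<and> dist (rhat (fst z)) (snd z) < R}"
  have "continuous_on ({Tm<..<Tp} \<times> UNIV) (\<lambda>z. dist (rhat (fst z)) (snd z))"
    by (intro continuous_intros continuous_on_compose2[OF continuous_rhat]) auto
  then have "open (({Tm<..<Tp} \<times> UNIV) \<inter> (\<lambda>z. dist (rhat (fst z)) (snd z)) -` {..<R})"
    by (rule continuous_open_preimage) (auto intro: open_Times)
  also have "({Tm<..<Tp} \<times> UNIV) \<inter> (\<lambda>z. dist (rhat (fst z)) (snd z)) -` {..<R} = U"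
    by (auto simp: U_def)
  finally have U: "open U" .
  have US: "U \<subseteq> S" by (auto simp: U_def mem_S)
  have atU: "at w within S = at w" if "w \<in> U" for w
    using U US that by (meson at_within_open_subset)
  have inner: "f2 w h k = f2 w k h" if w: "w \<in> U" for w
  proof -
    have "f2 w h k \<bullet> b = f2 w k h \<bullet> b" for b
    proof (rule second_derivative_symmetric_real[OF U w, of "\<lambda>z. f z \<bullet> b" "\<lambda>z h. f1 z h \<bullet> b" "\<lambda>z h k. f2 z h k \<bullet> b"])
      fix z assume z: "z \<in> U"
      show "((\<lambda>z. f z \<bullet> b) has_derivative (\<lambda>h. f1 z h \<bullet> b)) (at z)"
        using f[of z] z US atU[OF z] by (auto intro!: has_derivative_inner_left)
      show "((\<lambda>z. f1 z k \<bullet> b) has_derivative (\<lambda>h. f2 z h k \<bullet> b)) (at z)" for k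
        using f1[of z k] z US atU[OF z] by (auto intro!: has_derivative_inner_left)
    next
      show "continuous_on U (\<lambda>z. f2 z h k \<bullet> b)" for h k
        by (intro continuous_intros continuous_on_subset[OF f2 US])
    qed
    then show ?thesis by (metis vector_eq_rdot)
  qed
  obtain t x where tx: "z = (t, x)" by (cases z)
  have t: "t \<in> I" and x: "x \<in> ball_at t" using z tx mem_S by auto
  define tm where "tm = (Tm + Tp) / 2"
  have tm: "Tm < tm" "tm < Tp" using T by (auto simp: tm_def field_simps)
  define \<tau> where "\<tau> s = (1 - s) * t + s * tm" for s
  have tau: "\<tau> s \<in> I" if "s \<in> {0..1}" for s
  proof -
    have "convex I" by simp
    from convexD_alt[OF this t, of tm s] show ?thesis using tm that by (simp add: \<tau>_def)
  qed
  have tau': "\<tau> s \<in> {Tm<..<Tp}" if "s \<in> {0<..<1}" for s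
  proof -
    have "s * Tm < s * tm" "s * tm < s * Tp" "(1 - s) * Tm \<le> (1 - s) * t" "(1 - s) * t \<le> (1 - s) * Tp"
      using that tm t by (auto intro!: mult_strict_left_mono mult_left_mono)
    then show ?thesis by (auto simp: \<tau>_def algebra_simps)
  qed
  \<comment> \<open>The curve starts at z, moves time towards the midpoint and contracts the offset
    from the centre; both are needed to enter \<open>U\<close> from a point that is extreme in time
    and in space.\<close>
  define g where "g s = (\<tau> s, rhat (\<tau> s) + (1 - s) *\<^sub>R (x - rhat t))" for s
  have xr: "norm (x - rhat t) \<le> R" using x by (simp add: dist_norm norm_minus_commute)
  have gS: "g s \<in> S" if "s \<in> {0..1}" for s
  proof -
    have "(1 - s) * norm (x - rhat t) \<le> 1 * R" using that xr by (intro mult_mono) auto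
    then show ?thesis using tau[OF that] that by (simp add: g_def mem_S dist_norm)
  qed
  have gU: "g s \<in> U" if "s \<in> {0<..<1}" for s
  proof -
    have "(1 - s) * norm (x - rhat t) \<le> (1 - s) * R" using that xr by (intro mult_left_mono) auto
    also have "\<dots> < R" using that R by (simp add: algebra_simps)
    finally show ?thesis using tau'[OF that] that by (simp add: g_def U_def dist_norm)
  qed
  have "continuous_on {0..1} g"
    unfolding g_def
    by (intro continuous_intros continuous_on_compose2[OF continuous_rhat]) (use tau in \<open>auto simp: \<tau>_def intro!: continuous_intros\<close>)
  then have "continuous_on {0..1} (\<lambda>s. f2 (g s) h k - f2 (g s) k h)"
    using gS by (intro continuous_intros continuous_on_compose2[OF f2]) auto
  moreover have cl: "closure {0<..<1::real} = {0..1}" by simp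
  ultimately have "continuous_on (closure {0<..<1}) (\<lambda>s. f2 (g s) h k - f2 (g s) k h)" by (simp only: cl)
  then have "f2 (g 0) h k - f2 (g 0) k h = 0"
    by (rule continuous_constant_on_closure) (use inner[OF gU] cl in auto)
  then show ?thesis by (simp add: g_def \<tau>_def tx)
qed

end

section \<open>Integrals over moving balls and spheres\<close>

lemma continuous_on_sphere_compose:
  fixes f :: "real^3 \<Rightarrow> 'b::topological_space"
  assumes "continuous_on (cball p R) f" "R > 0"
  shows "continuous_on ({0..pi} \<times> {0..2*pi}) (\<lambda>(th, ph). f (p + R *\<^sub>R sph th ph))"
proof -
  have "continuous_on ({0..pi} \<times> {0..2*pi}) (\<lambda>z. f (p + R *\<^sub>R sph (fst z) (snd z)))"
    using assms(2) by (intro continuous_on_compose2[OF assms(1)] continuous_intros) (auto simp: dist_norm)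
  then show ?thesis by (simp add: case_prod_unfold)
qed

lemma sphere_integral_mono_abs:
  fixes f :: "real^3 \<Rightarrow> real"
  assumes f: "continuous_on (cball p R) f" and g: "continuous_on (cball p R) g" and R: "R > 0"
    and le: "\<And>x. x \<in> cball p R \<Longrightarrow> \<bar>f x\<bar> \<le> C * g x"
  shows "\<bar>sphere_integral p R f\<bar> \<le> C * sphere_integral p R g"
proof -
  let ?D = "{0..pi} \<times> {0..2*pi} :: (real \<times> real) set"
  have D: "?D = cbox (0, 0) (pi, 2*pi)" by (simp add: cbox_Pair_eq)
  have int: "(\<lambda>(th, ph). sin th * h (p + R *\<^sub>R sph th ph)) integrable_on ?D"
    if "continuous_on (cball p R) h" for h :: "real^3 \<Rightarrow> real"
    unfolding D
    using continuous_on_sphere_compose[OF that R] unfolding D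
    by (intro integrable_continuous) (auto simp: case_prod_unfold intro!: continuous_intros)
  have "norm (integral ?D (\<lambda>(th, ph). sin th * f (p + R *\<^sub>R sph th ph)))
      \<le> integral ?D (\<lambda>z. C * (case z of (th, ph) \<Rightarrow> sin th * g (p + R *\<^sub>R sph th ph)))"
  proof (rule integral_norm_bound_integral[OF int[OF f]])
    show "(\<lambda>z. C * (case z of (th, ph) \<Rightarrow> sin th * g (p + R *\<^sub>R sph th ph))) integrable_on ?D"
      using integrable_on_cmult_left[OF int[OF g], of C] by simp
    fix z assume z: "z \<in> ?D"
    obtain th ph where [simp]: "z = (th, ph)" by (cases z)
    have "\<bar>sin th\<bar> * \<bar>f (p + R *\<^sub>R sph th ph)\<bar> \<le> sin th * (C * g (p + R *\<^sub>R sph th ph))"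
      using z R le[of "p + R *\<^sub>R sph th ph"] sin_ge_zero[of th] by (auto intro!: mult_left_mono simp: dist_norm)
    then show "norm (case z of (th, ph) \<Rightarrow> sin th * f (p + R *\<^sub>R sph th ph))
        \<le> C * (case z of (th, ph) \<Rightarrow> sin th * g (p + R *\<^sub>R sph th ph))"
      by (simp add: abs_mult mult.left_commute)
  qed
  also have "\<dots> = C * integral ?D (\<lambda>(th, ph). sin th * g (p + R *\<^sub>R sph th ph))"
    by simp
  finally show ?thesis
    using R by (simp add: sphere_integral_def abs_mult mult.left_commute[of C] mult_left_mono)
qed

context tube
begin

lemma integrable_slice:
  fixes f :: "st \<Rightarrow> real"
  assumes "continuous_on S f" "t \<in> I"
  shows "continuous_on (ball_at t) (\<lambda>x. f (t, x))" "(\<lambda>x. f (t, x)) integrable_on ball_at t"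
proof -
  show c: "continuous_on (ball_at t) (\<lambda>x. f (t, x))"
    using assms(2) by (intro continuous_on_compose2[OF assms(1)] continuous_intros) (auto simp: mem_S)
  show "(\<lambda>x. f (t, x)) integrable_on ball_at t"
    using has_integral_cball_spherical[OF R c] by blast
qed

text \<open>In spherical coordinates about the moving centre the domain is a fixed box, so Leibniz'
  rule applies and yields the material derivative; no surface term arises at this stage.\<close>

lemma transport:
  fixes F :: "st \<Rightarrow> real"
  assumes F: "C1_on F F' S" and t: "t \<in> I"
  shows "((\<lambda>t. integral (ball_at t) (\<lambda>x. F (t, x))) has_vector_derivative
           integral (ball_at t) (\<lambda>x. F' (t, x) (1, v t))) (at t within I)"
proof -
  let ?K = "cbox (0, 0, 0) (R, pi, 2 * pi)"
  let ?y = "\<lambda>z::real\<times>real\<times>real. fst z *\<^sub>R sph (fst (snd z)) (snd (snd z))"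
  let ?w = "\<lambda>z::real\<times>real\<times>real. (fst z)\<^sup>2 * sin (fst (snd z))"
  have y: "norm (?y z) \<le> R" if "z \<in> ?K" for z
    using that by (cases z) (auto simp: cbox_Pair_eq)
  \<comment> \<open>\<open>C1_on\<close> gives continuity in fixed directions, whereas the direction
    \<open>(1, v t)\<close> varies with time; it is therefore expanded in the standard
    basis.\<close>
  have lin: "F' z (1, w) = F' z (1, 0) + (\<Sum>i\<in>UNIV. w $ i * F' z (0, axis i 1))" if "z \<in> S" for z w
  proof -
    interpret bounded_linear "F' z" using C1_onD(1)[OF F that] by (rule has_derivative_bounded_linear)
    have "(0, w) = (\<Sum>i\<in>UNIV. w $ i *\<^sub>R (0 :: real, axis i 1 :: real^3))"
      by (simp add: prod_eq_iff fst_sum snd_sum basis_expansion scalar_mult_eq_scaleR[symmetric])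
    then have "F' z (0, w) = (\<Sum>i\<in>UNIV. w $ i * F' z (0, axis i 1))"
      by (simp only: sum scaleR real_scaleR_def)
    moreover have "F' z (1, w) = F' z (1, 0) + F' z (0, w)" by (simp flip: add)
    ultimately show ?thesis by simp
  qed
  have cS: "continuous_on S (\<lambda>z. F' z (1, v (fst z)))"
  proof -
    have "continuous_on S (\<lambda>z. v (fst z))"
      by (rule continuous_on_compose2[OF v]) (auto simp: OmegaHat_def intro!: continuous_intros)
    then have "continuous_on S (\<lambda>z. F' z (1, 0) + (\<Sum>i\<in>UNIV. v (fst z) $ i * F' z (0, axis i 1)))"
      by (intro continuous_intros C1_onD(2)[OF F])
    then show ?thesis by (rule continuous_on_eq) (rule lin[symmetric])
  qed
  have pos: "continuous_on (I \<times> ?K) (\<lambda>(s, z). (s, rhat s + ?y z))"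
    unfolding case_prod_unfold by (intro continuous_intros continuous_on_compose2[OF continuous_rhat]) auto
  have pim: "(\<lambda>(s, z). (s, rhat s + ?y z)) ` (I \<times> ?K) \<subseteq> S"
    using y by (auto simp: mem_S dist_norm simp del: norm_scaleR)
  have eq: "integral (ball_at s) f = integral ?K (\<lambda>z. ?w z * f (rhat s + ?y z))"
    if "continuous_on (ball_at s) f" for s f
    using has_integral_cball_spherical[OF R that] by (simp add: integral_unique case_prod_unfold)
  have "((\<lambda>s. integral ?K (\<lambda>z. ?w z * F (s, rhat s + ?y z))) has_vector_derivative
          integral ?K (\<lambda>z. ?w z * F' (t, rhat t + ?y z) (1, v t))) (at t within I)"
  proof (rule leibniz_rule_vector_derivative[where fx = "\<lambda>s z. ?w z * F' (s, rhat s + ?y z) (1, v s)"])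
    fix s z assume s: "s \<in> I" and z: "z \<in> ?K"
    have "(F has_derivative F' (s, rhat s + ?y z)) (at (s, rhat s + ?y z) within S)"
      using s y[OF z] by (intro C1_onD(1)[OF F]) (auto simp: mem_S dist_norm simp del: norm_scaleR)
    from moving_derivative[OF this s y[OF z]]
    show "((\<lambda>s. ?w z * F (s, rhat s + ?y z)) has_vector_derivative ?w z * F' (s, rhat s + ?y z) (1, v s)) (at s within I)"
      by (rule has_vector_derivative_mult_right)
  next
    fix s assume s: "s \<in> I"
    have "continuous_on ?K (\<lambda>z. F (s, rhat s + ?y z))"
      using s y by (intro continuous_on_compose2[OF C1_onD(3)[OF F]] continuous_intros)
        (auto simp: mem_S dist_norm simp del: norm_scaleR)
    then show "(\<lambda>z. ?w z * F (s, rhat s + ?y z)) integrable_on ?K"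
      by (intro integrable_continuous continuous_intros)
  next
    show "continuous_on (I \<times> ?K) (\<lambda>(s, z). ?w z * F' (s, rhat s + ?y z) (1, v s))"
      using continuous_on_compose2[OF cS pos pim] unfolding case_prod_unfold fst_conv
      by (intro continuous_intros) auto
  qed (use t in auto)
  then have d: "((\<lambda>s. integral ?K (\<lambda>z. ?w z * F (s, rhat s + ?y z))) has_vector_derivative
          integral (ball_at t) (\<lambda>x. F' (t, x) (1, v t))) (at t within I)"
    using eq[OF integrable_slice(1)[OF cS t]] by simp
  show ?thesis
    by (rule has_vector_derivative_transform[OF t _ d])
      (rule eq[OF integrable_slice(1)[OF C1_onD(3)[OF F]]])
qed

text \<open>Because v depends on time only, the convective part v . grad F of the material
  derivative is the divergence of F v. Gauss' theorem for \<open>P + F v\<close> then turns all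
  divergences into one surface flux.\<close>

lemma balance_law:
  fixes F g :: "st \<Rightarrow> real" and P :: "st \<Rightarrow> real^3"
  assumes F: "C1_on F F' S" and P: "C1_on P P' S" and g: "continuous_on S g"
    and law: "\<And>z. z \<in> S \<Longrightarrow> F' z (1, 0) = (\<Sum>i\<in>UNIV. P' z (0, axis i 1) $ i) + g z"
    and t: "t \<in> I"
  shows "((\<lambda>t. integral (ball_at t) (\<lambda>x. F (t, x))) has_vector_derivative
           sphere_integral (rhat t) R (\<lambda>x. (P (t, x) + F (t, x) *\<^sub>R v t) \<bullet> ((x - rhat t) /\<^sub>R R))
           + integral (ball_at t) (\<lambda>x. g (t, x))) (at t within I)"
proof -
  define W where "W x = P (t, x) + F (t, x) *\<^sub>R v t" for x
  define W' where "W' x h = P' (t, x) (0, h) + F' (t, x) (0, h) *\<^sub>R v t" for x h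
  have W: "(W has_derivative W' x) (at x within ball_at t)" if "x \<in> ball_at t" for x
  proof -
    have z: "(t, x) \<in> S" using that t by (simp add: mem_S)
    note d = slice_derivative[OF C1_onD(1)[OF F z] z] slice_derivative[OF C1_onD(1)[OF P z] z]
    show ?thesis unfolding W_def W'_def by (intro derivative_intros d)
  qed
  have slice: "continuous_on (ball_at t) (\<lambda>x. f (t, x))" if "continuous_on S f" for f :: "st \<Rightarrow> 'z::topological_space"
    using t by (intro continuous_on_compose2[OF that] continuous_intros) (auto simp: mem_S)
  have Wc: "continuous_on (ball_at t) (\<lambda>x. W' x h)" for h
    unfolding W'_def by (intro continuous_intros slice C1_onD(2)[OF P] C1_onD(2)[OF F])
  have "integral (ball_at t) (\<lambda>x. F' (t, x) (1, v t))
      = integral (ball_at t) (\<lambda>x. (\<Sum>i\<in>UNIV. W' x (axis i 1) $ i) + g (t, x))"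
  proof (rule integral_cong)
    fix x assume "x \<in> ball_at t"
    then have z: "(t, x) \<in> S" using t by (simp add: mem_S)
    interpret bounded_linear "F' (t, x)" using C1_onD(1)[OF F z] by (rule has_derivative_bounded_linear)
    have "(0, v t) = (\<Sum>i\<in>UNIV. v t $ i *\<^sub>R (0 :: real, axis i 1 :: real^3))"
      by (simp add: prod_eq_iff fst_sum snd_sum basis_expansion scalar_mult_eq_scaleR[symmetric])
    then have "F' (t, x) (0, v t) = (\<Sum>i\<in>UNIV. v t $ i * F' (t, x) (0, axis i 1))"
      by (simp only: sum scaleR real_scaleR_def)
    moreover have "F' (t, x) (1, v t) = F' (t, x) (1, 0) + F' (t, x) (0, v t)" by (simp flip: add)
    ultimately show "F' (t, x) (1, v t) = (\<Sum>i\<in>UNIV. W' x (axis i 1) $ i) + g (t, x)"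
      by (simp add: law[OF z] W'_def sum.distrib mult.commute)
  qed
  also have "\<dots> = integral (ball_at t) (\<lambda>x. \<Sum>i\<in>UNIV. W' x (axis i 1) $ i) + integral (ball_at t) (\<lambda>x. g (t, x))"
  proof (rule integral_add)
    have "continuous_on (ball_at t) (\<lambda>x. \<Sum>i\<in>UNIV. W' x (axis i 1) $ i)" by (intro continuous_intros Wc)
    from has_integral_cball_spherical[OF R this]
    show "(\<lambda>x. \<Sum>i\<in>UNIV. W' x (axis i 1) $ i) integrable_on ball_at t" by blast
  qed (rule integrable_slice[OF g t])
  also have "integral (ball_at t) (\<lambda>x. \<Sum>i\<in>UNIV. W' x (axis i 1) $ i)
      = sphere_integral (rhat t) R (\<lambda>x. W x \<bullet> ((x - rhat t) /\<^sub>R R))"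
    by (rule gauss_cball[OF R W Wc])
  finally show ?thesis using transport[OF F t] by (simp add: W_def)
qed

end

section \<open>Balance laws for the Klein--Gordon equation\<close>

lemma has_derivative_power2_norm:
  fixes f :: "'a::real_normed_vector \<Rightarrow> 'b::real_inner"
  assumes "(f has_derivative f') (at z within S)"
  shows "((\<lambda>z. (norm (f z))\<^sup>2) has_derivative (\<lambda>h. 2 * (f z \<bullet> f' h))) (at z within S)"
  unfolding power2_norm_eq_inner
  by (rule has_derivative_eq_rhs[OF has_derivative_inner[OF assms assms]]) (simp add: inner_commute)

text \<open>One member of the sequence, with n fixed. In \<open>psi2 z h k\<close> the inner
  derivative is in direction k, the outer one in direction h. The nonlinearity is described on all
  of the complex plane, w = 0 included, by its role as the gradient of the potential term.\<close>

locale kg_tube = tube Tm Tp R rhat v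
  for Tm Tp R :: real and rhat v :: "real \<Rightarrow> real^3" +
  fixes c m q chi a :: real and G1 dG1 :: "real \<Rightarrow> real"
    and phi :: "st \<Rightarrow> real" and phi1 :: "st \<Rightarrow> st \<Rightarrow> real"
    and psi :: "st \<Rightarrow> complex" and psi1 :: "st \<Rightarrow> st \<Rightarrow> complex" and psi2 :: "st \<Rightarrow> st \<Rightarrow> st \<Rightarrow> complex"
  assumes c: "c > 0" and m: "m > 0" and chi: "chi > 0"
    and phi: "C1_on phi phi1 S"
    and psi: "C1_on psi psi1 S"
    and psi1: "\<And>k. C1_on (\<lambda>z. psi1 z k) (\<lambda>z h. psi2 z h k) S"
    and Ga: "\<And>w. ((\<lambda>w. Ga G1 a ((cmod w)\<^sup>2)) has_derivative (\<lambda>h. 2 * (Nl dG1 a w \<bullet> h))) (at w)"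
    and Nl: "\<And>h. continuous_on UNIV (\<lambda>w. Nl dG1 a w \<bullet> h)"
    and KG: "KG_eq c m q dG1 chi a phi S psi"
begin

abbreviation e0 :: st where "e0 \<equiv> (1, 0)"
abbreviation e :: "3 \<Rightarrow> st" where "e i \<equiv> (0, axis i 1)"
abbreviation kap where "kap \<equiv> kappa0 m c chi"

lemma kap: "kap = m * c / chi" "kap > 0"
  using c m chi by (auto simp: kappa0_def)

definition D0 where "D0 z = psi1 z e0 + \<i> * complex_of_real (q * phi z / chi) * psi z"
definition D0' where "D0' z h = psi2 z h e0
   + \<i> * (complex_of_real (q * phi1 z h / chi) * psi z + complex_of_real (q * phi z / chi) * psi1 z h)"

lemmas cont = C1_onD(2)[OF phi] C1_onD(3)[OF phi] C1_onD(2)[OF psi] C1_onD(3)[OF psi] C1_onD(2)[OF psi1] C1_onD(3)[OF psi1]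
lemmas deriv = C1_onD(1)[OF phi] C1_onD(1)[OF psi] C1_onD(1)[OF psi1]

lemma D0_C1: "C1_on D0 D0' S"
proof (rule C1_onI)
  fix z assume "z \<in> S"
  note d = deriv[OF this]
  have "((\<lambda>z. q * phi z / chi) has_derivative (\<lambda>h. q * phi1 z h / chi)) (at z within S)"
    using has_derivative_mult_right[OF d(1), of "q / chi"] by simp
  note r = has_derivative_add[OF d(3) has_derivative_mult[OF has_derivative_mult_right[OF has_derivative_of_real[OF this]] d(2)]]
  show "(D0 has_derivative D0' z) (at z within S)"
    unfolding D0_def D0'_def by (rule has_derivative_eq_rhs[OF r]) (simp add: algebra_simps)
qed (use chi in \<open>auto simp: D0'_def intro!: continuous_intros cont\<close>)

text \<open>Uniqueness within the tube identifies the derivatives chosen by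
  \<open>frechet_derivative\<close> with the explicit ones. For second derivatives the inner
  identity is available on \<open>S\<close> only, which suffices because the outer derivative is
  taken within \<open>S\<close>.\<close>

lemma pd_eq:
  assumes "z \<in> S"
  shows "pdt S psi z = psi1 z e0" "pdx S i psi z = psi1 z (e i)" "pdx S i (pdx S i psi) z = psi2 z (e i) (e i)"
    "pdx S i phi z = phi1 z (e i)"
proof -
  have 1: "pdt S psi w = psi1 w e0" "pdx S i psi w = psi1 w (e i)" "pdx S i phi w = phi1 w (e i)" if "w \<in> S" for w
    using frechet_derivative_eq[OF that deriv(2)[OF that]] frechet_derivative_eq[OF that deriv(1)[OF that]]
    by (simp_all add: pdt_def pdx_def)
  then show "pdt S psi z = psi1 z e0" "pdx S i psi z = psi1 z (e i)" "pdx S i phi z = phi1 z (e i)"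
    using assms by auto
  have d: "(pdx S i psi has_derivative (\<lambda>h. psi2 z h (e i))) (at z within S)"
    by (rule has_derivative_transform[OF assms _ deriv(3)[OF assms]]) (simp add: 1)
  then show "pdx S i (pdx S i psi) z = psi2 z (e i) (e i)"
    by (simp add: pdx_def[of S i "pdx S i psi"] frechet_derivative_eq[OF assms d])
qed

lemma tdt_eq: 
  assumes "z \<in> S"
  shows "tdt S q chi phi psi z = D0 z"
    "tdt S q chi phi (tdt S q chi phi psi) z = D0' z e0 + \<i> * complex_of_real (q * phi z / chi) * D0 z"
proof -
  have 1: "tdt S q chi phi psi w = D0 w" if "w \<in> S" for w
    using that by (simp add: tdt_def D0_def pd_eq)
  then show "tdt S q chi phi psi z = D0 z" using assms .
  have d: "(tdt S q chi phi psi has_derivative D0' z) (at z within S)"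
    by (rule has_derivative_transform[OF assms _ C1_onD(1)[OF D0_C1 assms]]) (simp add: 1)
  then show "tdt S q chi phi (tdt S q chi phi psi) z = D0' z e0 + \<i> * complex_of_real (q * phi z / chi) * D0 z"
    by (simp only: tdt_def[of S q chi phi "tdt S q chi phi psi"] pdt_def frechet_derivative_eq[OF assms d] 1[OF assms])
qed

lemma KG_solved:
  assumes "z \<in> S"
  shows "(\<Sum>i\<in>UNIV. psi2 z (e i) (e i)) = (D0' z e0 + \<i> * complex_of_real (q * phi z / chi) * D0 z) /\<^sub>R c\<^sup>2
     + Nl dG1 a (psi z) + kap\<^sup>2 *\<^sub>R psi z"
  using KG[unfolded KG_eq_def, rule_format, OF assms] 
  unfolding tdt_eq(2)[OF assms] lap_def pd_eq(3)[OF assms]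
  by (simp add: scaleR_conv_of_real divide_inverse algebra_simps)

lemma sym: "z \<in> S \<Longrightarrow> psi2 z h k = psi2 z k h"
  by (rule second_derivative_symmetric[of psi psi1 psi2]) (use deriv cont in auto)

definition grd where "grd z = (\<chi> i. psi1 z (e i))"

lemma norm_grd: "(norm (grd z))\<^sup>2 = (\<Sum>i\<in>UNIV. (cmod (psi1 z (e i)))\<^sup>2)"
  by (simp add: grd_def norm_vec_def L2_set_def sum_nonneg)

text \<open>\<open>En\<close>, \<open>Pn\<close>, \<open>Rn\<close>, \<open>Jn\<close> are the energy density, energy flux, charge density and current;
  primes denote their derivatives.  The real inner product encodes
  \<open>Im (cnj w * z) = (\<i> * w) \<bullet> z\<close>.\<close>

definition En where "En z = chi\<^sup>2 / (2 * m) * ((cmod (D0 z))\<^sup>2 / c\<^sup>2 + (norm (grd z))\<^sup>2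
   + Ga G1 a ((cmod (psi z))\<^sup>2) + kap\<^sup>2 * (cmod (psi z))\<^sup>2)"
definition En' where "En' z h = chi\<^sup>2 / m * ((D0 z \<bullet> D0' z h) / c\<^sup>2 + (\<Sum>i\<in>UNIV. psi1 z (e i) \<bullet> psi2 z h (e i))
   + Nl dG1 a (psi z) \<bullet> psi1 z h + kap\<^sup>2 * (psi z \<bullet> psi1 z h))"
definition Pn where "Pn z = (\<chi> i. chi\<^sup>2 / m * (D0 z \<bullet> psi1 z (e i)))"
definition Pn' where "Pn' z h = (\<chi> i. chi\<^sup>2 / m * (D0' z h \<bullet> psi1 z (e i) + D0 z \<bullet> psi2 z h (e i)))"
definition Rn where "Rn z = - (chi * q / (m * c\<^sup>2)) * ((\<i> * psi z) \<bullet> D0 z)"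
definition Rn' where "Rn' z h = - (chi * q / (m * c\<^sup>2)) * ((\<i> * psi1 z h) \<bullet> D0 z + (\<i> * psi z) \<bullet> D0' z h)"
definition Jn where "Jn z = (\<chi> i. chi * q / m * ((\<i> * psi z) \<bullet> psi1 z (e i)))"
definition Jn' where "Jn' z h = (\<chi> i. chi * q / m * ((\<i> * psi1 z h) \<bullet> psi1 z (e i) + (\<i> * psi z) \<bullet> psi2 z h (e i)))"

lemma energy_density_eq: "z \<in> S \<Longrightarrow> energy_density c m q G1 chi a phi S psi z = En z"
  by (simp add: energy_density_def tdt_eq grad_def pd_eq En_def grd_def)

lemma charge_density_eq: "z \<in> S \<Longrightarrow> charge_density c m q chi phi S psi z = Rn z"
  by (simp add: charge_density_def tdt_eq Rn_def inner_complex_def)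

lemma En_C1: "C1_on En En' S"
proof (rule C1_onI)
  fix z assume z: "z \<in> S"
  note d = deriv[OF z] C1_onD(1)[OF D0_C1 z]
  have g: "((\<lambda>z. Ga G1 a ((cmod (psi z))\<^sup>2)) has_derivative (\<lambda>h. 2 * (Nl dG1 a (psi z) \<bullet> psi1 z h))) (at z within S)"
    using has_derivative_compose[OF d(2) Ga] by simp
  note r = has_derivative_mult_right[OF has_derivative_add[OF has_derivative_add[OF has_derivative_add[OF
        bounded_linear.has_derivative[OF bounded_linear_divide has_derivative_power2_norm[OF d(4)]]
        has_derivative_sum[OF has_derivative_power2_norm[OF d(3)]]] g]
        has_derivative_mult_right[OF has_derivative_power2_norm[OF d(2)]]]]
  show "(En has_derivative En' z) (at z within S)"
    unfolding En_def En'_def norm_grd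
    by (rule has_derivative_eq_rhs[OF r]) (use m in \<open>auto simp: field_simps sum_distrib_left\<close>)
next
  show "continuous_on S (\<lambda>z. En' z h)" for h
  proof -
    \<comment> \<open>The direction \<open>psi1 z h\<close> depends on z while continuity of
      \<open>Nl\<close> is known for fixed directions, hence the expansion in the real basis 1,
      \<i>.\<close>
    have N: "Nl dG1 a w \<bullet> h = (Nl dG1 a w \<bullet> 1) * (h \<bullet> 1) + (Nl dG1 a w \<bullet> \<i>) * (h \<bullet> \<i>)" for w h
      by (simp add: inner_complex_def)
    have Nc: "continuous_on S (\<lambda>z. Nl dG1 a (psi z) \<bullet> h)" for h
      by (rule continuous_on_compose2[OF Nl cont(4)]) auto
    have "continuous_on S (\<lambda>z. (Nl dG1 a (psi z) \<bullet> 1) * (psi1 z h \<bullet> 1) + (Nl dG1 a (psi z) \<bullet> \<i>) * (psi1 z h \<bullet> \<i>))"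
      by (intro continuous_on_add continuous_on_mult Nc continuous_on_inner[OF cont(3)] continuous_on_const)
    then have Nc': "continuous_on S (\<lambda>z. Nl dG1 a (psi z) \<bullet> psi1 z h)"
      by (rule continuous_on_eq) (rule N[symmetric])
    show ?thesis unfolding En'_def
      by (intro continuous_on_add continuous_on_mult continuous_on_divide continuous_on_sum continuous_on_const Nc'
          continuous_on_inner[OF C1_onD(3)[OF D0_C1] C1_onD(2)[OF D0_C1]] continuous_on_inner[OF cont(6) cont(5)]
          continuous_on_inner[OF cont(4) cont(3)]) (use c in auto)
  qed
qed

lemma Pn_C1: "C1_on Pn Pn' S"
proof (rule C1_onI)
  fix z assume z: "z \<in> S"
  note d = deriv[OF z] C1_onD(1)[OF D0_C1 z]
  show "(Pn has_derivative Pn' z) (at z within S)"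
  proof (rule has_derivative_vec3I)
    fix i show "((\<lambda>x. Pn x $ i) has_derivative (\<lambda>h. Pn' z h $ i)) (at z within S)"
      unfolding Pn_def Pn'_def vec_lambda_beta
      by (rule derivative_eq_intros d refl | simp add: algebra_simps)+
  qed
qed (unfold Pn'_def, intro continuous_intros continuous_on_vec_lambda cont C1_onD(2,3)[OF D0_C1])

lemma Rn_C1: "C1_on Rn Rn' S"
proof (rule C1_onI)
  fix z assume z: "z \<in> S"
  note d = deriv[OF z] C1_onD(1)[OF D0_C1 z]
  show "(Rn has_derivative Rn' z) (at z within S)"
    unfolding Rn_def Rn'_def
    by (rule derivative_eq_intros d refl | simp add: algebra_simps)+
qed (unfold Rn'_def, intro continuous_intros cont C1_onD(2,3)[OF D0_C1])

lemma Jn_C1: "C1_on Jn Jn' S"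
proof (rule C1_onI)
  fix z assume z: "z \<in> S"
  note d = deriv[OF z] C1_onD(1)[OF D0_C1 z]
  show "(Jn has_derivative Jn' z) (at z within S)"
  proof (rule has_derivative_vec3I)
    fix i show "((\<lambda>x. Jn x $ i) has_derivative (\<lambda>h. Jn' z h $ i)) (at z within S)"
      unfolding Jn_def Jn'_def vec_lambda_beta
      by (rule derivative_eq_intros d refl | simp add: algebra_simps)+
  qed
qed (unfold Jn'_def, intro continuous_intros continuous_on_vec_lambda cont C1_onD(2,3)[OF D0_C1])

text \<open>Multiplication by \<i> is skew for the real inner product. This is why the potential,
  which always enters with a factor \<i>, drops out of so many products below.\<close>

lemma i_inner: "(\<i> * w) \<bullet> w = 0" "(\<i> * complex_of_real r * w) \<bullet> z = r * ((\<i> * w) \<bullet> z)"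
  "(\<i> * (complex_of_real r * w)) \<bullet> z = r * ((\<i> * w) \<bullet> z)"
  "z \<bullet> (\<i> * complex_of_real r * w) = r * ((\<i> * w) \<bullet> z)"
  by (simp_all add: inner_complex_def algebra_simps)

lemma Nl_inner: "z \<bullet> Nl dG1 a w = (dG1 (a ^ 3 * (cmod w)\<^sup>2) / a\<^sup>2) * (z \<bullet> w)"
  by (simp add: Nl_def inner_complex_def add_divide_distrib algebra_simps)

lemma D0_D0': "D0 z \<bullet> (D0' z e0 + \<i> * complex_of_real (q * phi z / chi) * D0 z) = D0 z \<bullet> D0' z e0"
  unfolding inner_add_right i_inner(4) i_inner(1) by simp

text \<open>The equation is paired with the covariant time derivative \<open>D0\<close>. Against
  \<open>psi\<close> and against the nonlinear term, a real multiple of \<open>psi\<close>,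
  \<open>D0\<close> acts like the plain time derivative, so these terms are time derivatives of the
  corresponding energies; the Laplacian joins the derivative of \<open>D0\<close> to form the
  divergence of \<open>Pn\<close>.\<close>

lemma energy_law:
  assumes z: "z \<in> S"
  shows "En' z e0 = (\<Sum>i\<in>UNIV. Pn' z (e i) $ i) + - (\<Sum>i\<in>UNIV. phi1 z (e i) * Jn z $ i)"
proof -
  have 1: "(\<Sum>i\<in>UNIV. D0 z \<bullet> psi2 z (e i) (e i)) = (D0 z \<bullet> D0' z e0) / c\<^sup>2 + D0 z \<bullet> Nl dG1 a (psi z) + kap\<^sup>2 * (D0 z \<bullet> psi z)"
    unfolding inner_sum_right[symmetric] KG_solved[OF z] inner_add_right[of _ _ "_ *\<^sub>R _"]
      inner_add_right[of _ _ "Nl _ _ _"] inner_scaleR_right D0_D0'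
    by (simp add: divide_inverse mult.commute)
  have 2: "D0 z \<bullet> psi z = psi1 z e0 \<bullet> psi z"
    unfolding D0_def inner_add_left i_inner(2) i_inner(1) by simp
  \<comment> \<open>Source of the electric force: the covariant time derivative and the i-th spatial
    derivative commute up to a multiplication by \<i> times the i-th derivative of the potential.
    Symmetry of second derivatives enters here.\<close>
  have 3: "D0' z (e i) \<bullet> psi1 z (e i) = psi1 z (e i) \<bullet> psi2 z e0 (e i) + q / chi * phi1 z (e i) * ((\<i> * psi z) \<bullet> psi1 z (e i))" for i
    unfolding D0'_def inner_add_left distrib_left i_inner(3) i_inner(1) sym[OF z, of "e i" e0]
    by (simp add: inner_commute)
  have 4: "Nl dG1 a (psi z) \<bullet> psi1 z e0 = D0 z \<bullet> Nl dG1 a (psi z)"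
    by (subst inner_commute) (simp add: Nl_inner 2)
  have "(\<Sum>i\<in>UNIV. Pn' z (e i) $ i) = chi\<^sup>2 / m * ((\<Sum>i\<in>UNIV. D0' z (e i) \<bullet> psi1 z (e i)) + (\<Sum>i\<in>UNIV. D0 z \<bullet> psi2 z (e i) (e i)))"
    by (simp only: Pn'_def vec_lambda_beta sum.distrib[symmetric] sum_distrib_left)
  also have "\<dots> = chi\<^sup>2 / m * ((\<Sum>i\<in>UNIV. psi1 z (e i) \<bullet> psi2 z e0 (e i)) + (\<Sum>i\<in>UNIV. q / chi * phi1 z (e i) * ((\<i> * psi z) \<bullet> psi1 z (e i)))
      + ((D0 z \<bullet> D0' z e0) / c\<^sup>2 + D0 z \<bullet> Nl dG1 a (psi z) + kap\<^sup>2 * (D0 z \<bullet> psi z)))"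
    by (simp only: 1 3 sum.distrib)
  also have "\<dots> = En' z e0 + chi\<^sup>2 / m * (\<Sum>i\<in>UNIV. q / chi * phi1 z (e i) * ((\<i> * psi z) \<bullet> psi1 z (e i)))"
    unfolding En'_def 4 2 by (simp add: inner_commute algebra_simps)
  also have "chi\<^sup>2 / m * (\<Sum>i\<in>UNIV. q / chi * phi1 z (e i) * ((\<i> * psi z) \<bullet> psi1 z (e i))) = (\<Sum>i\<in>UNIV. phi1 z (e i) * Jn z $ i)"
    using chi by (simp add: Jn_def sum_distrib_left power2_eq_square mult_ac)
  finally show ?thesis by simp
qed

text \<open>The equation is paired with \<open>\<i> * psi\<close>: the mass and nonlinear terms are
  real multiples of \<open>psi\<close> and vanish, which is the gauge invariance behind charge
  conservation.\<close>

lemma charge_law: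
  assumes z: "z \<in> S"
  shows "Rn' z e0 = (\<Sum>i\<in>UNIV. - Jn' z (e i) $ i)"
proof -
  have "(\<i> * psi z) \<bullet> (\<Sum>i\<in>UNIV. psi2 z (e i) (e i)) = ((\<i> * psi z) \<bullet> (D0' z e0 + \<i> * complex_of_real (q * phi z / chi) * D0 z)) / c\<^sup>2"
    unfolding KG_solved[OF z] inner_add_right[of _ _ "_ *\<^sub>R _"] inner_add_right[of _ _ "Nl _ _ _"] inner_scaleR_right Nl_inner
    by (simp add: i_inner(1) divide_inverse mult.commute)
  also have "(\<i> * psi z) \<bullet> (D0' z e0 + \<i> * complex_of_real (q * phi z / chi) * D0 z)
      = (\<i> * psi z) \<bullet> D0' z e0 + (\<i> * psi1 z e0) \<bullet> D0 z"
    by (simp add: D0_def inner_complex_def algebra_simps)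
  finally have 1: "(\<Sum>i\<in>UNIV. (\<i> * psi z) \<bullet> psi2 z (e i) (e i)) = ((\<i> * psi z) \<bullet> D0' z e0 + (\<i> * psi1 z e0) \<bullet> D0 z) / c\<^sup>2"
    by (simp add: inner_sum_right)
  have "(\<Sum>i\<in>UNIV. - Jn' z (e i) $ i) = - (chi * q / m) * (\<Sum>i\<in>UNIV. (\<i> * psi z) \<bullet> psi2 z (e i) (e i))"
    by (simp add: Jn'_def i_inner(1) sum_negf sum_distrib_left sum_divide_distrib)
  then show ?thesis unfolding 1 using c m by (simp add: Rn'_def field_simps)
qed

end

section \<open>Bounds by the concentration density\<close>

lemma abs_diff_le_of_derivative_bound:
  fixes f :: "real \<Rightarrow> real"
  assumes "\<And>t. t \<in> {a..b} \<Longrightarrow> (f has_vector_derivative f' t) (at t within {a..b})"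
    and "\<And>t. t \<in> {a..b} \<Longrightarrow> \<bar>f' t\<bar> \<le> C" and "s \<in> {a..b}" "t \<in> {a..b}"
  shows "\<bar>f t - f s\<bar> \<le> (b - a) * C"
proof -
  have "norm (f t - f s) \<le> C * norm (t - s)"
    using assms by (intro field_differentiable_bound[where S = "{a..b}" and f' = f'])
      (auto simp: has_real_derivative_iff_has_vector_derivative)
  also have "\<dots> \<le> C * (b - a)"
    using assms(2)[OF assms(3)] assms(3,4) by (intro mult_left_mono) auto
  finally show ?thesis by (simp add: mult.commute)
qed

lemma abs_sum_3_le:
  fixes f :: "3 \<Rightarrow> real"
  assumes "\<And>i. \<bar>f i\<bar> \<le> C"
  shows "\<bar>\<Sum>i\<in>UNIV. f i\<bar> \<le> 3 * C"
  unfolding sum_3 using assms[of 1] assms[of 2] assms[of 3] by linarith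

context kg_tube
begin

text \<open>The energy density with its potential term in absolute value; \<open>Ga\<close> may be
  negative, so \<open>En\<close> need not control the other densities.\<close>

definition Ep where "Ep z = chi\<^sup>2 / (2 * m) * ((cmod (D0 z))\<^sup>2 / c\<^sup>2 + (norm (grd z))\<^sup>2
   + \<bar>Ga G1 a ((cmod (psi z))\<^sup>2)\<bar> + kap\<^sup>2 * (cmod (psi z))\<^sup>2)"
definition Qn where "Qn z = (aC m c chi)\<^sup>2 * ((cmod (psi1 z e0))\<^sup>2 / c\<^sup>2 + (norm (grd z))\<^sup>2)
   + (aC m c chi)\<^sup>2 * \<bar>Ga G1 a ((cmod (psi z))\<^sup>2)\<bar> + (cmod (psi z))\<^sup>2"

lemma Qn_eq:
  "z \<in> S \<Longrightarrow> (aC m c chi)\<^sup>2 * (norm (grad0 c S psi z))\<^sup>2 + (aC m c chi)\<^sup>2 * \<bar>Ga G1 a ((cmod (psi z))\<^sup>2)\<bar>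
     + (cmod (psi z))\<^sup>2 = Qn z"
  using c by (simp add: Qn_def grad0_def pd_eq grad_def grd_def norm_prod_def power_mult_distrib power_divide divide_inverse power_inverse mult.commute)

lemma Qn_nonneg: "Qn z \<ge> 0"
  by (simp add: Qn_def)

lemma continuous_Ga: "continuous_on S (\<lambda>z. Ga G1 a ((cmod (psi z))\<^sup>2))"
proof -
  have "continuous_on UNIV (\<lambda>w. Ga G1 a ((cmod w)\<^sup>2))"
    using has_derivative_continuous[OF Ga] by (simp add: continuous_on_eq_continuous_at)
  from continuous_on_compose2[OF this cont(4)] show ?thesis by simp
qed

lemma continuous_Qn: "continuous_on S Qn"
  unfolding Qn_def norm_grd by (intro continuous_intros cont continuous_Ga) (use c in auto)

text \<open>Flux, charge and current are each, up to a constant, bounded by a product of two of the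
  quantities |D0|/c, |grad psi| and kap |psi|, whose squares occur in \<open>Ep\<close>; the
  inequality 2xy <= x^2 + y^2 does the rest. A factor kap = mc/chi supplies the power of chi that
  the charge and the current lack.\<close>

lemma abs_En: "\<bar>En z\<bar> \<le> Ep z"
  and norm_Pn: "norm (Pn z) \<le> c * Ep z"
  and abs_Rn: "\<bar>Rn z\<bar> \<le> \<bar>q\<bar> / (m * c\<^sup>2) * Ep z"
  and norm_Jn: "norm (Jn z) \<le> \<bar>q\<bar> / (m * c) * Ep z"
proof -
  let ?d = "cmod (D0 z)" and ?g = "norm (grd z)" and ?p = "cmod (psi z)" and ?G = "\<bar>Ga G1 a ((cmod (psi z))\<^sup>2)\<bar>"
  show "\<bar>En z\<bar> \<le> Ep z"
  proof -
    have "0 \<le> ?d\<^sup>2 / c\<^sup>2" "0 \<le> ?g\<^sup>2" "0 \<le> kap\<^sup>2 * ?p\<^sup>2" by auto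
    then have "\<bar>?d\<^sup>2 / c\<^sup>2 + ?g\<^sup>2 + Ga G1 a (?p\<^sup>2) + kap\<^sup>2 * ?p\<^sup>2\<bar> \<le> ?d\<^sup>2 / c\<^sup>2 + ?g\<^sup>2 + ?G + kap\<^sup>2 * ?p\<^sup>2"
      by linarith
    then show ?thesis
      unfolding En_def Ep_def abs_mult using m by (intro mult_mono) auto
  qed
  have amgm: "2 * x * y \<le> x\<^sup>2 + y\<^sup>2" for x y :: real
    using zero_le_power2[of "x - y"] by (simp add: power2_diff)
  have d: "(?d / c)\<^sup>2 = ?d\<^sup>2 / c\<^sup>2" "(kap * ?p)\<^sup>2 = kap\<^sup>2 * ?p\<^sup>2"
    by (simp_all add: power_divide power_mult_distrib)
  have part: "chi\<^sup>2 / (2 * m) * y \<le> Ep z" if "y \<le> ?d\<^sup>2 / c\<^sup>2 + ?g\<^sup>2 + ?G + kap\<^sup>2 * ?p\<^sup>2" for y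
    unfolding Ep_def using that m by (intro mult_left_mono) auto
  have nn: "0 \<le> ?d\<^sup>2 / c\<^sup>2" "0 \<le> ?g\<^sup>2" "0 \<le> kap\<^sup>2 * ?p\<^sup>2" "0 \<le> ?G" by auto
  have bd: "2 * (?d / c) * ?g \<le> ?d\<^sup>2 / c\<^sup>2 + ?g\<^sup>2 + ?G + kap\<^sup>2 * ?p\<^sup>2"
    "2 * (?d / c) * (kap * ?p) \<le> ?d\<^sup>2 / c\<^sup>2 + ?g\<^sup>2 + ?G + kap\<^sup>2 * ?p\<^sup>2"
    "2 * ?g * (kap * ?p) \<le> ?d\<^sup>2 / c\<^sup>2 + ?g\<^sup>2 + ?G + kap\<^sup>2 * ?p\<^sup>2"
    using amgm[of "?d / c" ?g] amgm[of "?d / c" "kap * ?p"] amgm[of ?g "kap * ?p"] nn unfolding d by linarith+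
  have "norm (Pn z) \<le> norm ((chi\<^sup>2 / m * ?d) *\<^sub>R grd z)"
  proof (rule norm_le_componentwise_cart)
    fix i show "norm (Pn z $ i) \<le> norm (((chi\<^sup>2 / m * ?d) *\<^sub>R grd z) $ i)"
      using m by (simp add: Pn_def grd_def abs_mult mult.assoc divide_right_mono mult_left_mono Cauchy_Schwarz_ineq2)
  qed
  also have "\<dots> = c * (chi\<^sup>2 / (2 * m) * (2 * (?d / c) * ?g))"
    using m c by (simp add: field_simps)
  also have "\<dots> \<le> c * Ep z"
    by (rule mult_left_mono[OF part[OF bd(1)]]) (use c in auto)
  finally show "norm (Pn z) \<le> c * Ep z" .
  have "\<bar>Rn z\<bar> = \<bar>chi * q / (m * c\<^sup>2)\<bar> * \<bar>(\<i> * psi z) \<bullet> D0 z\<bar>"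
    by (simp add: Rn_def abs_mult)
  also have "\<dots> \<le> \<bar>chi * q / (m * c\<^sup>2)\<bar> * (?p * ?d)"
    using Cauchy_Schwarz_ineq2[of "\<i> * psi z" "D0 z"] by (intro mult_left_mono) (auto simp: norm_mult)
  also have "\<dots> = \<bar>q\<bar> / (m * c\<^sup>2) * (chi\<^sup>2 / (2 * m) * (2 * (?d / c) * (kap * ?p)))"
    using m c chi by (simp add: kap field_simps abs_mult power2_eq_square)
  also have "\<dots> \<le> \<bar>q\<bar> / (m * c\<^sup>2) * Ep z"
    by (rule mult_left_mono[OF part[OF bd(2)]]) (use c m in auto)
  finally show "\<bar>Rn z\<bar> \<le> \<bar>q\<bar> / (m * c\<^sup>2) * Ep z" .
  have "norm (Jn z) \<le> norm ((chi * \<bar>q\<bar> / m * ?p) *\<^sub>R grd z)"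
  proof (rule norm_le_componentwise_cart)
    fix i 
    have "\<bar>(\<i> * psi z) \<bullet> psi1 z (e i)\<bar> \<le> ?p * cmod (psi1 z (e i))"
      using Cauchy_Schwarz_ineq2[of "\<i> * psi z" "psi1 z (e i)"] by (simp add: norm_mult)
    from mult_left_mono[OF this, of "chi * \<bar>q\<bar> / m"]
    show "norm (Jn z $ i) \<le> norm (((chi * \<bar>q\<bar> / m * ?p) *\<^sub>R grd z) $ i)"
      using m chi by (simp add: Jn_def grd_def abs_mult mult.assoc)
  qed
  also have "\<dots> = \<bar>q\<bar> / (m * c) * (chi\<^sup>2 / (2 * m) * (2 * ?g * (kap * ?p)))"
    using m c chi by (simp add: kap field_simps abs_mult power2_eq_square)
  also have "\<dots> \<le> \<bar>q\<bar> / (m * c) * Ep z"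
    by (rule mult_left_mono[OF part[OF bd(3)]]) (use c m in auto)
  finally show "norm (Jn z) \<le> \<bar>q\<bar> / (m * c) * Ep z" .
qed

text \<open>Since chi^2/(2m) = (m c^2/2) aC^2 and aC kap = 1, \<open>Ep\<close> is comparable with
  the density of conditions (i) and (ii). Splitting the potential off \<open>D0\<close> doubles the
  time derivative term and adds q^2 B^2/(m c^2); chi cancels there, so the constant is uniform in
  n.\<close>

lemma Ep_le:
  assumes B: "\<bar>phi z\<bar> \<le> B"
  shows "Ep z \<le> (2 * m * c\<^sup>2 + q\<^sup>2 * B\<^sup>2 / (m * c\<^sup>2)) * Qn z"
proof -
  let ?x = "cmod (psi1 z e0)" and ?g = "norm (grd z)" and ?p = "cmod (psi z)" and ?G = "\<bar>Ga G1 a ((cmod (psi z))\<^sup>2)\<bar>"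
  have "cmod (D0 z) \<le> ?x + \<bar>q * phi z / chi\<bar> * ?p"
    unfolding D0_def using norm_triangle_ineq[of "psi1 z e0" "\<i> * complex_of_real (q * phi z / chi) * psi z"]
    by (simp only: norm_mult norm_of_real norm_ii mult_1)
  also have "\<dots> \<le> ?x + \<bar>q\<bar> * B / chi * ?p"
    using B chi by (intro add_left_mono mult_right_mono) (auto simp: abs_mult divide_right_mono mult_left_mono)
  finally have "(cmod (D0 z))\<^sup>2 \<le> (?x + \<bar>q\<bar> * B / chi * ?p)\<^sup>2" by (intro power_mono) auto
  also have "\<dots> \<le> 2 * ?x\<^sup>2 + 2 * (\<bar>q\<bar> * B / chi * ?p)\<^sup>2"
    using zero_le_power2[of "?x - \<bar>q\<bar> * B / chi * ?p"] by (simp add: power2_diff power2_sum)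
  finally have d: "(cmod (D0 z))\<^sup>2 \<le> 2 * ?x\<^sup>2 + 2 * (\<bar>q\<bar> * B / chi * ?p)\<^sup>2" .
  have "Ep z \<le> chi\<^sup>2 / (2 * m) * ((2 * ?x\<^sup>2 + 2 * (\<bar>q\<bar> * B / chi * ?p)\<^sup>2) / c\<^sup>2 + ?g\<^sup>2 + ?G + kap\<^sup>2 * ?p\<^sup>2)"
    unfolding Ep_def using d m by (intro mult_left_mono add_right_mono divide_right_mono) auto
  also have "\<dots> = m * c\<^sup>2 * ((aC m c chi)\<^sup>2 * (?x\<^sup>2 / c\<^sup>2)) + m * c\<^sup>2 / 2 * ((aC m c chi)\<^sup>2 * ?g\<^sup>2)
      + m * c\<^sup>2 / 2 * ((aC m c chi)\<^sup>2 * ?G) + (q\<^sup>2 * B\<^sup>2 / (m * c\<^sup>2) + m * c\<^sup>2 / 2) * ?p\<^sup>2"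
    using m c chi by (simp add: kap aC_def power_mult_distrib power_divide field_simps power2_eq_square)
  also have "\<dots> \<le> (2 * m * c\<^sup>2 + q\<^sup>2 * B\<^sup>2 / (m * c\<^sup>2)) * ((aC m c chi)\<^sup>2 * (?x\<^sup>2 / c\<^sup>2))
      + (2 * m * c\<^sup>2 + q\<^sup>2 * B\<^sup>2 / (m * c\<^sup>2)) * ((aC m c chi)\<^sup>2 * ?g\<^sup>2)
      + (2 * m * c\<^sup>2 + q\<^sup>2 * B\<^sup>2 / (m * c\<^sup>2)) * ((aC m c chi)\<^sup>2 * ?G)
      + (2 * m * c\<^sup>2 + q\<^sup>2 * B\<^sup>2 / (m * c\<^sup>2)) * ?p\<^sup>2"
  proof -
    have "0 \<le> m * c\<^sup>2" "0 \<le> q\<^sup>2 * B\<^sup>2 / (m * c\<^sup>2)" using m by auto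
    then have k: "m * c\<^sup>2 \<le> 2 * m * c\<^sup>2 + q\<^sup>2 * B\<^sup>2 / (m * c\<^sup>2)"
      "m * c\<^sup>2 / 2 \<le> 2 * m * c\<^sup>2 + q\<^sup>2 * B\<^sup>2 / (m * c\<^sup>2)"
      "q\<^sup>2 * B\<^sup>2 / (m * c\<^sup>2) + m * c\<^sup>2 / 2 \<le> 2 * m * c\<^sup>2 + q\<^sup>2 * B\<^sup>2 / (m * c\<^sup>2)"
      by linarith+
    show ?thesis
      by (rule add_mono[OF add_mono[OF add_mono[OF mult_right_mono[OF k(1)] mult_right_mono[OF k(2)]]
              mult_right_mono[OF k(2)]] mult_right_mono[OF k(3)]]) auto
  qed
  finally show ?thesis by (simp add: Qn_def algebra_simps)
qed

section \<open>Integrated balance laws and bounds for their terms\<close>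

lemma energy_balance:
  assumes t: "t \<in> I"
  shows "((\<lambda>t. integral (ball_at t) (\<lambda>x. En (t, x))) has_vector_derivative
    sphere_integral (rhat t) R (\<lambda>x. (Pn (t, x) + En (t, x) *\<^sub>R v t) \<bullet> ((x - rhat t) /\<^sub>R R))
     + integral (ball_at t) (\<lambda>x. - (\<Sum>i\<in>UNIV. phi1 (t, x) (e i) * Jn (t, x) $ i))) (at t within I)"
  by (rule balance_law[OF En_C1 Pn_C1 _ energy_law t]) (intro continuous_intros cont C1_onD(3)[OF Jn_C1])

lemma charge_balance:
  assumes t: "t \<in> I"
  shows "((\<lambda>t. integral (ball_at t) (\<lambda>x. Rn (t, x))) has_vector_derivative
    sphere_integral (rhat t) R (\<lambda>x. (- Jn (t, x) + Rn (t, x) *\<^sub>R v t) \<bullet> ((x - rhat t) /\<^sub>R R))) (at t within I)"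
proof -
  have "C1_on (\<lambda>z. - Jn z) (\<lambda>z h. - Jn' z h) S"
    using Jn_C1 by (auto simp: C1_on_def intro!: derivative_intros continuous_intros)
  from balance_law[OF Rn_C1 this continuous_on_const _ t, of 0] charge_law
  show ?thesis by simp
qed

lemma continuous_v: "continuous_on S (\<lambda>z. v (fst z))"
  by (rule continuous_on_compose2[OF v]) (auto simp: OmegaHat_def intro!: continuous_intros)

definition dev where "dev k z = snd z $ k - rhat (fst z) $ k"

lemma dev_C1: "C1_on (dev k) (\<lambda>z h. snd h $ k - fst h * v (fst z) $ k) S"
proof (rule C1_onI)
  fix z assume "z \<in> S"
  then have "fst z \<in> I" by (auto simp: OmegaHat_def)
  from rhat[OF this] have r: "(rhat has_derivative (\<lambda>h. h *\<^sub>R v (fst z))) (at (fst z) within I)"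
    by (simp add: has_vector_derivative_def)
  have "(rhat has_derivative (\<lambda>h. h *\<^sub>R v (fst z))) (at (fst z) within fst ` S)"
    by (rule has_derivative_subset[OF r]) (auto simp: OmegaHat_def)
  from has_derivative_in_compose[OF has_derivative_fst[OF has_derivative_ident] this]
  have d: "((\<lambda>z. rhat (fst z)) has_derivative (\<lambda>h. fst h *\<^sub>R v (fst z))) (at z within S)" .
  show "(dev k has_derivative (\<lambda>h. snd h $ k - fst h * v (fst z) $ k)) (at z within S)"
    unfolding dev_def
    using bounded_linear.has_derivative[OF bounded_linear_vec_nth d, of k]
    by (intro has_derivative_diff bounded_linear.has_derivative[OF bounded_linear_vec_nth] has_derivative_snd has_derivative_ident) simp
next
  show "continuous_on S (\<lambda>z. snd h $ k - fst h * v (fst z) $ k)" for h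
    by (intro continuous_intros continuous_v)
qed

text \<open>The charge law is multiplied by a component of the offset. The product rule moves the
  factor under the divergence; its spatial derivative releases the current component
  \<open>Jn $ k\<close>, its time derivative the convective term with \<open>v\<close>.\<close>

lemma moment_balance:
  assumes t: "t \<in> I"
  shows "((\<lambda>t. integral (ball_at t) (\<lambda>x. dev k (t, x) * Rn (t, x))) has_vector_derivative
    sphere_integral (rhat t) R (\<lambda>x. (- dev k (t, x) *\<^sub>R Jn (t, x) + (dev k (t, x) * Rn (t, x)) *\<^sub>R v t) \<bullet> ((x - rhat t) /\<^sub>R R))
     + integral (ball_at t) (\<lambda>x. Jn (t, x) $ k - v t $ k * Rn (t, x))) (at t within I)"
proof -
  let ?d' = "\<lambda>z h. snd h $ k - fst h * v (fst z) $ k"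
  have 1: "C1_on (\<lambda>z. dev k z * Rn z) (\<lambda>z h. dev k z * Rn' z h + ?d' z h * Rn z) S"
    by (rule C1_onI, rule has_derivative_mult)
      (auto intro!: continuous_intros C1_onD(1)[OF dev_C1] C1_onD(1)[OF Rn_C1] continuous_v C1_onD(3)[OF dev_C1] C1_onD(2,3)[OF Rn_C1])
  have 2: "C1_on (\<lambda>z. - dev k z *\<^sub>R Jn z) (\<lambda>z h. - dev k z *\<^sub>R Jn' z h + (- ?d' z h) *\<^sub>R Jn z) S"
    by (rule C1_onI, rule has_derivative_scaleR[OF has_derivative_minus])
      (auto intro!: continuous_intros C1_onD(1)[OF dev_C1] C1_onD(1)[OF Jn_C1] continuous_v C1_onD(3)[OF dev_C1] C1_onD(2,3)[OF Jn_C1])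
  have 3: "continuous_on S (\<lambda>z. Jn z $ k - v (fst z) $ k * Rn z)"
    by (intro continuous_intros continuous_v C1_onD(3)[OF Jn_C1] C1_onD(3)[OF Rn_C1])
  have "dev k z * Rn' z e0 + ?d' z e0 * Rn z
      = (\<Sum>i\<in>UNIV. (- dev k z *\<^sub>R Jn' z (e i) + (- ?d' z (e i)) *\<^sub>R Jn z) $ i) + (Jn z $ k - v (fst z) $ k * Rn z)"
    if z: "z \<in> S" for z
  proof -
    have "(\<Sum>i\<in>UNIV. axis i 1 $ k * Jn z $ i) = Jn z $ k"
      using sum.delta[of UNIV k "\<lambda>i. Jn z $ i"] by (simp add: axis_def if_distrib[of "\<lambda>x. x * _"] cong: if_cong)
    moreover have "dev k z * Rn' z e0 = (\<Sum>i\<in>UNIV. - (dev k z * Jn' z (e i) $ i))"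
      by (simp add: charge_law[OF z] sum_distrib_left)
    ultimately show ?thesis by (simp add: sum.distrib sum_negf sum_subtractf)
  qed
  from balance_law[OF 1 2 3 this t] show ?thesis by simp
qed

lemma integral_bound_Qn:
  fixes f :: "st \<Rightarrow> real"
  assumes f: "continuous_on S f" and t: "t \<in> I" and le: "\<And>x. x \<in> ball_at t \<Longrightarrow> \<bar>f (t, x)\<bar> \<le> C * Qn (t, x)"
  shows "\<bar>integral (ball_at t) (\<lambda>x. f (t, x))\<bar> \<le> C * integral (ball_at t) (\<lambda>x. Qn (t, x))"
proof -
  have "norm (integral (ball_at t) (\<lambda>x. f (t, x))) \<le> integral (ball_at t) (\<lambda>x. C * Qn (t, x))"
    by (rule integral_norm_bound_integral[OF integrable_slice(2)[OF f t]])
      (use le integrable_slice(2)[OF continuous_Qn t] in \<open>auto intro: integrable_on_mult_right\<close>)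
  then show ?thesis by simp
qed

lemma sphere_bound_Qn:
  fixes W :: "st \<Rightarrow> real^3"
  assumes W: "continuous_on S W" and t: "t \<in> I" and le: "\<And>x. x \<in> ball_at t \<Longrightarrow> norm (W (t, x)) \<le> C * Qn (t, x)"
  shows "\<bar>sphere_integral (rhat t) R (\<lambda>x. W (t, x) \<bullet> ((x - rhat t) /\<^sub>R R))\<bar> \<le> C * sphere_integral (rhat t) R (\<lambda>x. Qn (t, x))"
proof (rule sphere_integral_mono_abs[OF _ integrable_slice(1)[OF continuous_Qn t] R])
  have "continuous_on (ball_at t) (\<lambda>x. W (t, x))"
    using t by (intro continuous_on_compose2[OF W] continuous_intros) (auto simp: mem_S)
  then show "continuous_on (ball_at t) (\<lambda>x. W (t, x) \<bullet> ((x - rhat t) /\<^sub>R R))"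
    by (intro continuous_intros)
  fix x assume x: "x \<in> ball_at t"
  have "\<bar>W (t, x) \<bullet> ((x - rhat t) /\<^sub>R R)\<bar> \<le> norm (W (t, x)) * norm ((x - rhat t) /\<^sub>R R)"
    by (rule Cauchy_Schwarz_ineq2)
  also have "\<dots> \<le> norm (W (t, x)) * 1"
  proof (rule mult_left_mono)
    have "norm ((x - rhat t) /\<^sub>R R) = norm (x - rhat t) / R" using R by (simp only: norm_scaleR) (simp add: divide_inverse mult.commute)
    then show "norm ((x - rhat t) /\<^sub>R R) \<le> 1" using x R by (simp add: dist_norm norm_minus_commute)
  qed simp
  finally show "\<bar>W (t, x) \<bullet> ((x - rhat t) /\<^sub>R R)\<bar> \<le> C * Qn (t, x)" using le[OF x] by simp
qed

end

section \<open>The energy estimate for one member of the sequence\<close>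

context kg_tube
begin

text \<open>One number d bounds all small quantities: radius, surface integral, field error and the
  two initial errors. \<open>L\<close> compares the four densities with \<open>Qn\<close>,
  \<open>LV\<close> adds the convective flux, \<open>N\<close> collects initial error and drift of
  the charge, and \<open>A\<close> bounds the derivative of the corrected energy, so the conclusion
  is linear in d.\<close>

lemma energy_deviation:
  fixes ginf ginf' :: "real \<Rightarrow> real^3" and B V G M d Einf rhoinf t0 :: real
  defines "KE \<equiv> 2 * m * c\<^sup>2 + q\<^sup>2 * B\<^sup>2 / (m * c\<^sup>2)"
  defines "L \<equiv> (1 + c + \<bar>q\<bar> / (m * c\<^sup>2) + \<bar>q\<bar> / (m * c)) * KE"
  defines "LV \<equiv> L + L * V"
  defines "N \<equiv> 1 + (Tp - Tm) * LV"
  defines "A \<equiv> LV + L * M + 3 * (G * (L * M)) + 3 * (G * LV) + V * G * N"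
  assumes B: "\<And>z. z \<in> S \<Longrightarrow> \<bar>phi z\<bar> \<le> B"
    and V: "\<And>t. t \<in> I \<Longrightarrow> norm (v t) \<le> V"
    and ginf: "\<And>t. t \<in> I \<Longrightarrow> (ginf has_vector_derivative ginf' t) (at t within I)"
    and G: "\<And>t. t \<in> I \<Longrightarrow> norm (ginf t) \<le> G" "\<And>t. t \<in> I \<Longrightarrow> norm (ginf' t) \<le> G"
    and M: "\<And>t. t \<in> I \<Longrightarrow> integral (ball_at t) (\<lambda>x. Qn (t, x)) \<le> M"
    and sphere: "\<And>t. t \<in> I \<Longrightarrow> sphere_integral (rhat t) R (\<lambda>x. Qn (t, x)) \<le> d"
    and field: "\<And>z. z \<in> S \<Longrightarrow> norm ((\<chi> i. phi1 z (e i)) - ginf (fst z)) \<le> d"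
    and R_d: "R \<le> d" "R \<le> 1"
    and t0: "t0 \<in> I"
    and rho0: "\<bar>integral (ball_at t0) (\<lambda>x. Rn (t0, x)) - rhoinf\<bar> \<le> d"
    and En0: "\<bar>integral (ball_at t0) (\<lambda>x. En (t0, x)) - Einf\<bar> \<le> d"
    and t: "t \<in> I"
  shows "\<bar>integral (ball_at t) (\<lambda>x. En (t, x)) - (Einf - rhoinf * (LBINT s=ereal t0..ereal t. v s \<bullet> ginf s))\<bar>
           \<le> (1 + 6 * (G * (L * M)) + (Tp - Tm) * A) * d"
proof -
  have d0: "0 < d" using R R_d by linarith
  have KE0: "0 \<le> KE" using m by (simp add: KE_def)
  have G0: "0 \<le> G" and V0: "0 \<le> V" using G(1)[OF t0] V[OF t0] norm_ge_zero order_trans by blast+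
  have fr: "0 \<le> \<bar>q\<bar> / (m * c\<^sup>2)" "0 \<le> \<bar>q\<bar> / (m * c)" using m c by auto
  have L0: "0 \<le> L" using KE0 c fr by (simp add: L_def)
  have LV0: "0 \<le> LV" using L0 V0 by (simp add: LV_def)
  \<comment> \<open>The factor in \<open>L\<close> sums the four nonnegative constants of the
    pointwise bounds, so a single \<open>L\<close> serves every density.\<close>
  have Lb: "x \<le> L * Qn z" if "z \<in> S" "x \<le> k * Ep z" "k \<in> {1, c, \<bar>q\<bar> / (m * c\<^sup>2), \<bar>q\<bar> / (m * c)}" for x k z
  proof -
    have k0: "0 \<le> k" and k1: "k \<le> 1 + c + \<bar>q\<bar> / (m * c\<^sup>2) + \<bar>q\<bar> / (m * c)" using that(3) fr c by auto
    have "k * Ep z \<le> k * (KE * Qn z)"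
      using Ep_le[OF B[OF that(1)]] k0 unfolding KE_def by (rule mult_left_mono)
    also have "\<dots> \<le> (1 + c + \<bar>q\<bar> / (m * c\<^sup>2) + \<bar>q\<bar> / (m * c)) * (KE * Qn z)"
      using k1 KE0 Qn_nonneg by (intro mult_right_mono) auto
    finally show ?thesis using that(2) by (simp add: L_def mult.assoc)
  qed
  have bE: "\<bar>En z\<bar> \<le> L * Qn z" and bP: "norm (Pn z) \<le> L * Qn z" and bR: "\<bar>Rn z\<bar> \<le> L * Qn z"
    and bJ: "norm (Jn z) \<le> L * Qn z" if "z \<in> S" for z
    using Lb[OF that, of _ 1] Lb[OF that norm_Pn] Lb[OF that abs_Rn] Lb[OF that norm_Jn] abs_En[of z] by auto
  have Q0: "0 \<le> Qn z" for z by (rule Qn_nonneg)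
  have flux: "norm (W z + F z *\<^sub>R v (fst z)) \<le> LV * Qn z"
    if "z \<in> S" "norm (W z) \<le> L * Qn z" "\<bar>F z\<bar> \<le> L * Qn z" for W :: "st \<Rightarrow> real^3" and F z
  proof -
    have v: "norm (v (fst z)) \<le> V" using that(1) V by (auto simp: OmegaHat_def)
    have "norm (W z + F z *\<^sub>R v (fst z)) \<le> norm (W z) + \<bar>F z\<bar> * norm (v (fst z))"
      using norm_triangle_ineq[of "W z" "F z *\<^sub>R v (fst z)"] by simp
    also have "\<dots> \<le> L * Qn z + L * Qn z * V"
      using that v L0 Q0 by (intro add_mono mult_mono) auto
    finally show ?thesis by (simp add: LV_def algebra_simps)
  qed
  have sph: "\<bar>sphere_integral (rhat s) R (\<lambda>x. (W (s, x) + F (s, x) *\<^sub>R v s) \<bullet> ((x - rhat s) /\<^sub>R R))\<bar> \<le> LV * d"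
    if "continuous_on S W" "continuous_on S F" "\<And>z. z \<in> S \<Longrightarrow> norm (W z) \<le> L * Qn z" "\<And>z. z \<in> S \<Longrightarrow> \<bar>F z\<bar> \<le> L * Qn z" "s \<in> I"
    for W :: "st \<Rightarrow> real^3" and F s
  proof -
    have "\<bar>sphere_integral (rhat s) R (\<lambda>x. (W (s, x) + F (s, x) *\<^sub>R v (fst (s, x))) \<bullet> ((x - rhat s) /\<^sub>R R))\<bar>
        \<le> LV * sphere_integral (rhat s) R (\<lambda>x. Qn (s, x))"
    proof (rule sphere_bound_Qn[where W = "\<lambda>z. W z + F z *\<^sub>R v (fst z)", OF _ that(5)])
      show "continuous_on S (\<lambda>z. W z + F z *\<^sub>R v (fst z))"
        by (intro continuous_intros that continuous_v)
      fix x assume "x \<in> ball_at s"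
      then have "(s, x) \<in> S" using that(5) by (simp add: mem_S)
      then show "norm (W (s, x) + F (s, x) *\<^sub>R v (fst (s, x))) \<le> LV * Qn (s, x)"
        using that(3,4) by (intro flux)
    qed
    also have "\<dots> \<le> LV * d" using sphere[OF that(5)] LV0 by (rule mult_left_mono)
    finally show ?thesis by simp
  qed
  note C = C1_onD(3)[OF En_C1] C1_onD(3)[OF Pn_C1] C1_onD(3)[OF Rn_C1] C1_onD(3)[OF Jn_C1] C1_onD(3)[OF dev_C1]
  have devR: "\<bar>dev k z\<bar> \<le> R" if "z \<in> S" for k z
  proof -
    have "\<bar>(snd z - rhat (fst z)) $ k\<bar> \<le> norm (snd z - rhat (fst z))" by (rule component_le_norm_cart)
    also have "\<dots> \<le> R" using that by (auto simp: OmegaHat_def dist_norm norm_minus_commute)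
    finally show ?thesis by (simp add: dev_def)
  qed
  \<comment> \<open>R <= 1 is used here: fluxes weighted by the offset obey the same bound as the
    unweighted ones.\<close>
  have dev1: "\<bar>dev k z\<bar> * y \<le> L * Qn z" if "z \<in> S" "0 \<le> y" "y \<le> L * Qn z" for k z y
  proof -
    have "\<bar>dev k z\<bar> * y \<le> 1 * y" using devR[OF that(1)] R_d that by (intro mult_right_mono) (auto intro: order_trans)
    then show ?thesis using that by simp
  qed
  define sE where "sE s = sphere_integral (rhat s) R (\<lambda>x. (Pn (s, x) + En (s, x) *\<^sub>R v s) \<bullet> ((x - rhat s) /\<^sub>R R))" for s
  define sR where "sR s = sphere_integral (rhat s) R (\<lambda>x. (- Jn (s, x) + Rn (s, x) *\<^sub>R v s) \<bullet> ((x - rhat s) /\<^sub>R R))" for s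
  define sM where "sM k s = sphere_integral (rhat s) R
     (\<lambda>x. (- dev k (s, x) *\<^sub>R Jn (s, x) + (dev k (s, x) * Rn (s, x)) *\<^sub>R v s) \<bullet> ((x - rhat s) /\<^sub>R R))" for k s
  have sE: "\<bar>sE s\<bar> \<le> LV * d" if "s \<in> I" for s
    unfolding sE_def by (rule sph[where W = Pn and F = En]) (use C bP bE that in auto)
  have sR: "\<bar>sR s\<bar> \<le> LV * d" if "s \<in> I" for s
    unfolding sR_def by (rule sph[where W = "\<lambda>z. - Jn z" and F = Rn]) (use C bJ bR that in \<open>auto intro: continuous_intros\<close>)
  have sM: "\<bar>sM k s\<bar> \<le> LV * d" if "s \<in> I" for k s
    unfolding sM_def
    by (rule sph[where W = "\<lambda>z. - dev k z *\<^sub>R Jn z" and F = "\<lambda>z. dev k z * Rn z"])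
      (use C bJ bR that dev1 in \<open>auto intro!: continuous_intros simp: abs_mult\<close>)
  define Eb where "Eb s = integral (ball_at s) (\<lambda>x. En (s, x))" for s
  define Rb where "Rb s = integral (ball_at s) (\<lambda>x. Rn (s, x))" for s
  define Mb where "Mb k s = integral (ball_at s) (\<lambda>x. dev k (s, x) * Rn (s, x))" for k s
  define Jb where "Jb k s = integral (ball_at s) (\<lambda>x. Jn (s, x) $ k)" for k s
  define Fb where "Fb s = integral (ball_at s) (\<lambda>x. - (\<Sum>i\<in>UNIV. phi1 (s, x) (e i) * Jn (s, x) $ i))" for s
  have Rb: "\<bar>Rb s - rhoinf\<bar> \<le> N * d" if "s \<in> I" for s
  proof -
    have "\<bar>Rb s - Rb t0\<bar> \<le> (Tp - Tm) * (LV * d)"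
    proof (rule abs_diff_le_of_derivative_bound[where f = Rb and f' = sR])
      show "(Rb has_vector_derivative sR u) (at u within I)" if "u \<in> I" for u
        unfolding Rb_def sR_def by (rule charge_balance[OF that])
    qed (use sR t0 that in auto)
    then show ?thesis using rho0 by (simp add: N_def Rb_def algebra_simps)
  qed
  have Mb: "\<bar>Mb k s\<bar> \<le> L * M * d" if s: "s \<in> I" for k s
  proof -
    have "\<bar>Mb k s\<bar> \<le> (R * L) * integral (ball_at s) (\<lambda>x. Qn (s, x))"
      unfolding Mb_def
    proof (rule integral_bound_Qn[where f = "\<lambda>z. dev k z * Rn z", OF _ s])
      show "continuous_on S (\<lambda>z. dev k z * Rn z)" by (intro continuous_intros C)
      fix x assume "x \<in> ball_at s"
      then have z: "(s, x) \<in> S" using s by (simp add: mem_S)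
      have "\<bar>dev k (s, x)\<bar> * \<bar>Rn (s, x)\<bar> \<le> R * (L * Qn (s, x))"
        using devR[OF z] bR[OF z] R by (intro mult_mono) auto
      then show "\<bar>dev k (s, x) * Rn (s, x)\<bar> \<le> R * L * Qn (s, x)" by (simp add: abs_mult mult.assoc)
    qed
    also have "\<dots> \<le> (R * L) * M" using M[OF s] R L0 by (intro mult_left_mono) auto
    also have "\<dots> \<le> (d * L) * M"
    proof -
      have "0 \<le> integral (ball_at s) (\<lambda>x. Qn (s, x))"
        by (rule integral_nonneg[OF integrable_slice(2)[OF continuous_Qn s]]) (rule Q0)
      then have "0 \<le> M" using M[OF s] by linarith
      then show ?thesis using R_d L0 by (intro mult_right_mono) auto
    qed
    finally show ?thesis by (simp add: mult_ac)
  qed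
  have slice: "(\<lambda>x. f (s, x)) integrable_on ball_at s" if "continuous_on S f" "s \<in> I" for f :: "st \<Rightarrow> real" and s
    by (rule integrable_slice(2)[OF that])
  \<comment> \<open>Replacing the gradient of the potential by its limit costs at most d times the
    integral of |Jn|, itself at most \<open>L * M\<close>. The limit depends on time alone and so
    leaves the integral.\<close>
  have FJ: "\<bar>Fb s + (\<Sum>k\<in>UNIV. ginf s $ k * Jb k s)\<bar> \<le> L * M * d" if s: "s \<in> I" for s
  proof -
    let ?f = "\<lambda>z. - (\<Sum>i\<in>UNIV. phi1 z (e i) * Jn z $ i) + (\<Sum>k\<in>UNIV. ginf s $ k * Jn z $ k)"
    have c1: "continuous_on S (\<lambda>z. Jn z $ k)" "continuous_on S (\<lambda>z. - (\<Sum>i\<in>UNIV. phi1 z (e i) * Jn z $ i))" for k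
      by (intro continuous_intros C cont)+
    have "Fb s + (\<Sum>k\<in>UNIV. ginf s $ k * Jb k s) = integral (ball_at s) (\<lambda>x. ?f (s, x))"
    proof -
      have "(\<Sum>k\<in>UNIV. ginf s $ k * Jb k s) = integral (ball_at s) (\<lambda>x. \<Sum>k\<in>UNIV. ginf s $ k * Jn (s, x) $ k)"
        unfolding Jb_def integral_mult_right[symmetric]
        by (rule integral_sum[symmetric]) (use slice[OF c1(1) s] in \<open>auto intro: integrable_on_mult_right\<close>)
      also have "Fb s + \<dots> = integral (ball_at s) (\<lambda>x. ?f (s, x))"
        unfolding Fb_def
        by (rule integral_add[symmetric])
          (use slice[OF c1(2) s] slice[OF c1(1) s] in \<open>auto intro!: integrable_sum integrable_on_mult_right\<close>)
      finally show ?thesis .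
    qed
    also have "\<bar>\<dots>\<bar> \<le> (d * L) * integral (ball_at s) (\<lambda>x. Qn (s, x))"
    proof (rule integral_bound_Qn[where f = ?f, OF _ s])
      show "continuous_on S ?f" by (intro continuous_intros C cont)
      fix x assume "x \<in> ball_at s"
      then have z: "(s, x) \<in> S" using s by (simp add: mem_S)
      have "?f (s, x) = - (((\<chi> i. phi1 (s, x) (e i)) - ginf s) \<bullet> Jn (s, x))"
        by (simp add: inner_vec_def algebra_simps sum_subtractf)
      also have "\<bar>\<dots>\<bar> \<le> norm ((\<chi> i. phi1 (s, x) (e i)) - ginf s) * norm (Jn (s, x))"
        using Cauchy_Schwarz_ineq2 by simp
      also have "\<dots> \<le> d * (L * Qn (s, x))"
        using field[OF z] bJ[OF z] d0 by (intro mult_mono) auto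
      finally show "\<bar>?f (s, x)\<bar> \<le> d * L * Qn (s, x)" by (simp add: mult.assoc)
    qed
    also have "\<dots> \<le> (d * L) * M" using M[OF s] d0 L0 by (intro mult_left_mono) auto
    finally show ?thesis by (simp add: mult_ac)
  qed
  define w where "w s = v s \<bullet> ginf s" for s
  have gc: "continuous_on I ginf"
    using ginf has_vector_derivative_continuous continuous_on_eq_continuous_within by blast
  have wc: "continuous_on I w" unfolding w_def by (intro continuous_intros v gc)
  have gk: "((\<lambda>s. ginf s $ k) has_vector_derivative ginf' s $ k) (at s within I)" if "s \<in> I" for s k
    using bounded_linear.has_vector_derivative[OF bounded_linear_vec_nth ginf[OF that]] .
  define f where "f s = Eb s + (\<Sum>k\<in>UNIV. ginf s $ k * Mb k s) + rhoinf * (LBINT u=t0..s. w u)" for s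
  define f' where "f' s = (sE s + Fb s) + (\<Sum>k\<in>UNIV. ginf s $ k * (sM k s + (Jb k s - v s $ k * Rb s)) + ginf' s $ k * Mb k s)
      + rhoinf * w s" for s
  have f: "(f has_vector_derivative f' s) (at s within I)" if s: "s \<in> I" for s
  proof -
    have 1: "(Eb has_vector_derivative sE s + Fb s) (at s within I)"
      unfolding Eb_def sE_def Fb_def by (rule energy_balance[OF s])
    have 2: "(Mb k has_vector_derivative sM k s + (Jb k s - v s $ k * Rb s)) (at s within I)" for k
    proof -
      have "integral (ball_at s) (\<lambda>x. Jn (s, x) $ k - v s $ k * Rn (s, x)) = Jb k s - v s $ k * Rb s"
        unfolding Jb_def Rb_def
        using slice[OF C(3) s] slice[of "\<lambda>z. Jn z $ k", OF _ s] C(4)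
        by (subst integral_diff) (auto intro!: continuous_intros integrable_on_mult_right)
      then show ?thesis using moment_balance[OF s, of k] unfolding Mb_def sM_def by simp
    qed
    have 3: "((\<lambda>s. LBINT u=t0..s. w u) has_vector_derivative w s) (at s within I)"
      using t0 s by (intro interval_integral_FTC2[OF _ _ wc]) auto
    show ?thesis unfolding f_def f'_def
      by (intro has_vector_derivative_add 1 has_vector_derivative_sum has_vector_derivative_mult gk[OF s] 2 3
          has_vector_derivative_mult_right)
  qed
  \<comment> \<open>The regrouping pairs what is not small: the force \<open>Fb\<close> with the
    currents from the moment, and \<open>rhoinf\<close> with the charge \<open>Rb\<close>. Every
    summand now carries a flux, field error, moment or charge error.\<close>
  have f'_eq: "f' s = sE s + (Fb s + (\<Sum>k\<in>UNIV. ginf s $ k * Jb k s)) + (\<Sum>k\<in>UNIV. ginf s $ k * sM k s)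
      + (\<Sum>k\<in>UNIV. ginf' s $ k * Mb k s) + w s * (rhoinf - Rb s)" for s
    by (simp add: f'_def w_def inner_vec_def sum.distrib sum_subtractf sum_distrib_left sum_distrib_right algebra_simps)
  have comp: "\<bar>g $ k * y\<bar> \<le> G * Y" if "norm g \<le> G" "\<bar>y\<bar> \<le> Y" for g :: "real^3" and k y Y
    unfolding abs_mult using that component_le_norm_cart[of g k] G0 by (intro mult_mono) auto
  have f': "\<bar>f' s\<bar> \<le> A * d" if s: "s \<in> I" for s
  proof -
    have "\<bar>w s\<bar> \<le> V * G"
      unfolding w_def using Cauchy_Schwarz_ineq2[of "v s" "ginf s"] V[OF s] G(1)[OF s] V0
      by (intro order_trans[OF Cauchy_Schwarz_ineq2] mult_mono) auto
    then have "\<bar>w s * (rhoinf - Rb s)\<bar> \<le> V * G * (N * d)"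
      unfolding abs_mult using Rb[OF s] V0 G0 by (intro mult_mono) (auto simp: abs_minus_commute)
    moreover have "\<bar>\<Sum>k\<in>UNIV. ginf s $ k * sM k s\<bar> \<le> 3 * (G * (LV * d))"
      by (rule abs_sum_3_le, rule comp) (use G s sM in auto)
    moreover have "\<bar>\<Sum>k\<in>UNIV. ginf' s $ k * Mb k s\<bar> \<le> 3 * (G * (L * M * d))"
      by (rule abs_sum_3_le, rule comp) (use G s Mb in auto)
    ultimately have "\<bar>f' s\<bar> \<le> LV * d + L * M * d + 3 * (G * (LV * d)) + 3 * (G * (L * M * d)) + V * G * (N * d)"
      unfolding f'_eq using sE[OF s] FJ[OF s] by linarith
    then show ?thesis by (simp add: A_def algebra_simps)
  qed
  have "\<bar>f t - f t0\<bar> \<le> (Tp - Tm) * (A * d)"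
    by (rule abs_diff_le_of_derivative_bound[OF f f' t0 t])
  \<comment> \<open>The correction is estimated at both \<open>t\<close> and \<open>t0\<close>;
    three components each give the factor 6.\<close>
  moreover have "\<bar>\<Sum>k\<in>UNIV. ginf s $ k * Mb k s\<bar> \<le> 3 * (G * (L * M * d))" if "s \<in> I" for s
    by (rule abs_sum_3_le, rule comp) (use G that Mb in auto)
  note this[OF t] this[OF t0]
  moreover have "\<bar>Eb t0 - Einf\<bar> \<le> d" using En0 by (simp add: Eb_def)
  moreover have "f t0 = Eb t0 + (\<Sum>k\<in>UNIV. ginf t0 $ k * Mb k t0)" by (simp add: f_def)
  ultimately have "\<bar>Eb t - (Einf - rhoinf * (LBINT u=t0..t. w u))\<bar> \<le> d + 6 * (G * (L * M * d)) + (Tp - Tm) * (A * d)"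
    unfolding f_def[of t] by linarith
  then show ?thesis unfolding Eb_def w_def by (simp add: algebra_simps)
qed

end

section \<open>Convergence of the restricted energy\<close>

text \<open>At \<open>w = 0\<close>, where \<open>dG1 0\<close> is arbitrary, the derivative vanishes because the function is even.\<close>

lemma Ga_facts:
  fixes G1 dG1 :: "real \<Rightarrow> real" and a :: real
  assumes a: "a > 0"
    and der: "\<And>s. s > 0 \<Longrightarrow> (G1 has_real_derivative dG1 s) (at s)"
    and C1: "C1_holder al (\<lambda>w::complex. G1 ((cmod w)\<^sup>2))" and al: "al > 0"
  shows "((\<lambda>w. Ga G1 a ((cmod w)\<^sup>2)) has_derivative (\<lambda>h. 2 * (Nl dG1 a w \<bullet> h))) (at w)"
    and "continuous_on UNIV (\<lambda>w. Nl dG1 a w \<bullet> h)"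
proof -
  let ?g = "\<lambda>w::complex. G1 ((cmod w)\<^sup>2)"
  obtain D where D: "\<And>z. (?g has_derivative blinfun_apply (D z)) (at z)" and hol: "locally_holder al D"
    using C1 unfolding C1_holder_def by blast
  have D_eq: "blinfun_apply (D w) h = 2 * dG1 ((cmod w)\<^sup>2) * (w \<bullet> h)" for w h
  proof (cases "w = 0")
    case True
    have "((\<lambda>z. ?g (- z)) has_derivative (\<lambda>h. blinfun_apply (D 0) (- h))) (at 0)"
      using has_derivative_compose[of uminus uminus 0 UNIV ?g "blinfun_apply (D 0)"] D[of 0]
      by (auto intro: derivative_intros)
    then have "(?g has_derivative (\<lambda>h. blinfun_apply (D 0) (- h))) (at 0)" by simp
    from fun_cong[OF has_derivative_unique[OF this D[of 0]], of h] have "blinfun_apply (D 0) (- h) = blinfun_apply (D 0) h" .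
    then show ?thesis using True by (simp add: blinfun.minus_right)
  next
    case False
    then have "(cmod w)\<^sup>2 > 0" by simp
    from der[OF this] have 1: "(G1 has_derivative (\<lambda>x. x * dG1 ((cmod w)\<^sup>2))) (at ((cmod w)\<^sup>2))"
      by (simp add: has_field_derivative_def mult_commute_abs)
    have 2: "((\<lambda>w::complex. (cmod w)\<^sup>2) has_derivative (\<lambda>h. 2 * (w \<bullet> h))) (at w)"
      by (rule has_derivative_power2_norm) (rule has_derivative_ident)
    from has_derivative_unique[OF has_derivative_compose[OF 2 1] D[of w]]
    have "(\<lambda>h. 2 * (w \<bullet> h) * dG1 ((cmod w)\<^sup>2)) = blinfun_apply (D w)" .
    then show ?thesis by (metis mult.commute mult.left_commute)
  qed
  have Dc: "isCont D w" for w
  proof -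
    obtain C where C: "\<And>x y. x \<in> cball w 1 \<Longrightarrow> y \<in> cball w 1 \<Longrightarrow> dist (D x) (D y) \<le> C * dist x y powr al"
      using hol compact_cball unfolding locally_holder_def by meson
    have "((\<lambda>x. C * dist x w powr al) \<longlongrightarrow> C * 0 powr al) (at w)"
      using al by (intro tendsto_intros) (auto intro!: tendsto_eq_intros)
    then have "((\<lambda>x. C * dist x w powr al) \<longlongrightarrow> 0) (at w)" by simp
    moreover have "\<forall>\<^sub>F x in at w. norm (dist (D x) (D w)) \<le> C * dist x w powr al"
    proof -
      have "\<forall>\<^sub>F x in at w. x \<in> ball w 1" by (intro eventually_at_in_open') auto
      then show ?thesis by eventually_elim (use C in auto)
    qed
    ultimately have "((\<lambda>x. dist (D x) (D w)) \<longlongrightarrow> 0) (at w)" by (rule Lim_null_comparison[rotated])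
    then show ?thesis unfolding isCont_def by (subst tendsto_dist_iff)
  qed
  \<comment> \<open>b = a^(3/2), so that \<open>Ga G1 a\<close> at |w|^2 is a^(-5) times
    \<open>G1\<close> at |b w|^2: the rescaled potential is the original one composed with a
    dilation.\<close>
  define b where "b = sqrt a ^ 3"
  have "b\<^sup>2 = ((sqrt a)\<^sup>2) ^ 3"
    by (simp add: b_def flip: power_mult)
  then have b2: "b\<^sup>2 = a ^ 3" using a by simp
  have cb: "(cmod (b *\<^sub>R w))\<^sup>2 = a ^ 3 * (cmod w)\<^sup>2" for w
    by (simp add: power_mult_distrib b2)
  have N: "2 * (Nl dG1 a w \<bullet> h) = blinfun_apply (D (b *\<^sub>R w)) (b *\<^sub>R h) / a ^ 5" for w h
  proof -
    have "blinfun_apply (D (b *\<^sub>R w)) (b *\<^sub>R h) = 2 * dG1 (a ^ 3 * (cmod w)\<^sup>2) * (b\<^sup>2 * (w \<bullet> h))"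
      unfolding D_eq cb by (simp add: power2_eq_square)
    also have "\<dots> / a ^ 5 = 2 * (dG1 (a ^ 3 * (cmod w)\<^sup>2) / a\<^sup>2) * (w \<bullet> h)"
      unfolding b2 using a by (simp add: field_simps power_numeral_reduce)
    also have "\<dots> = 2 * (Nl dG1 a w \<bullet> h)"
      by (simp add: Nl_def inner_complex_def algebra_simps add_divide_distrib)
    finally show ?thesis ..
  qed
  have "((\<lambda>w. ?g (b *\<^sub>R w) / a ^ 5) has_derivative (\<lambda>h. blinfun_apply (D (b *\<^sub>R w)) (b *\<^sub>R h) / a ^ 5)) (at w)"
    using has_derivative_compose[OF bounded_linear_imp_has_derivative[OF bounded_linear_scaleR_right] D]
    by (intro bounded_linear.has_derivative[OF bounded_linear_divide])
  then show "((\<lambda>w. Ga G1 a ((cmod w)\<^sup>2)) has_derivative (\<lambda>h. 2 * (Nl dG1 a w \<bullet> h))) (at w)"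
    by (simp only: Ga_def cb N)
  have "continuous_on UNIV D" using Dc continuous_on_eq_continuous_at by blast
  then have "continuous_on UNIV (\<lambda>w. D (b *\<^sub>R w))"
    by (rule continuous_on_compose2) (auto intro!: continuous_intros)
  then have "continuous_on UNIV (\<lambda>w. blinfun_apply (D (b *\<^sub>R w)) (b *\<^sub>R h) / a ^ 5 / 2)"
    using a by (intro continuous_intros) auto
  then show "continuous_on UNIV (\<lambda>w. Nl dG1 a w \<bullet> h)"
    by (rule continuous_on_eq) (simp flip: N)
qed

lemma C2_within_C1_on:
  assumes "C2_within f S"
  obtains f1 f2 where "C1_on f f1 S" "\<And>k. C1_on (\<lambda>z. f1 z k) (\<lambda>z h. f2 z h k) S"
proof -
  obtain D D2 where D: "\<And>z. z \<in> S \<Longrightarrow> (f has_derivative blinfun_apply (D z)) (at z within S)"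
    and D2: "\<And>z. z \<in> S \<Longrightarrow> (D has_derivative blinfun_apply (D2 z)) (at z within S)"
    and c: "continuous_on S D2"
    using assms unfolding C2_within_def by blast
  have Dc: "continuous_on S D"
    using D2 has_derivative_continuous continuous_on_eq_continuous_within by blast
  show ?thesis
  proof
    show "C1_on f (\<lambda>z. blinfun_apply (D z)) S"
      by (rule C1_onI[OF D]) (auto intro!: continuous_intros Dc)
    show "C1_on (\<lambda>z. blinfun_apply (D z) k) (\<lambda>z h. blinfun_apply (blinfun_apply (D2 z) h) k) S" for k
    proof (rule C1_onI)
      fix z assume "z \<in> S"
      show "((\<lambda>z. blinfun_apply (D z) k) has_derivative (\<lambda>h. blinfun_apply (blinfun_apply (D2 z) h) k)) (at z within S)"
        using bounded_linear.has_derivative[OF blinfun.bounded_linear_left D2[OF \<open>z \<in> S\<close>]] .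
    qed (auto intro!: continuous_intros c)
  qed
qed

text \<open>The gradient here is again the one selected within the tube. On a time slice the
  function is affine, and uniqueness on the ball forces its slope, at boundary points as
  well.\<close>

lemma (in tube) grad_affine:
  assumes f: "(f has_derivative f') (at (t, x) within S)" and z: "(t, x) \<in> S"
    and aff: "\<And>y. f (t, y) = \<alpha> + (y - p) \<bullet> g"
  shows "grad S f (t, x) = g"
proof -
  have x: "x \<in> ball_at t" using z by (simp add: mem_S)
  have "((\<lambda>y. f (t, y)) has_derivative (\<lambda>h. h \<bullet> g)) (at x within ball_at t)"
    unfolding aff by (auto intro!: derivative_eq_intros)
  from fun_cong[OF has_derivative_unique_cball[OF R x slice_derivative[OF f z] this]]
  have "f' (0, h) = h \<bullet> g" for h .
  then show ?thesis
    using frechet_derivative_eq[OF z f] by (simp add: grad_def pdx_def vec_eq_iff inner_axis')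
qed

lemma sphere_integral_cong:
  assumes "\<And>x. x \<in> cball p r \<Longrightarrow> f x = g x" "r > 0"
  shows "sphere_integral p r f = sphere_integral p r g"
  unfolding sphere_integral_def using assms
  by (auto intro!: integral_cong arg_cong[where f = "\<lambda>x. r\<^sup>2 * x"] simp: dist_norm)

theorem theorem2:
  fixes c m q :: real
    and G1 dG1 :: "real \<Rightarrow> real"
    and Tm Tp :: real
    and rhat :: "real \<Rightarrow> real^3"
    and R a chi :: "nat \<Rightarrow> real"
    and phi :: "nat \<Rightarrow> st \<Rightarrow> real"
    and phiinf :: "st \<Rightarrow> real"
    and ginf :: "real \<Rightarrow> real^3"
    and psi :: "nat \<Rightarrow> st \<Rightarrow> complex"
    and t0 Einf0 rhoinf :: real
  defines "I \<equiv> {Tm..Tp}"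
    and "Om \<equiv> \<lambda>n. OmegaHat Tm Tp rhat (R n)"
    and "Ebar \<equiv> \<lambda>n t. integral (cball (rhat t) (R n))
                        (\<lambda>x. energy_density c m q G1 (chi n) (a n) (phi n) (OmegaHat Tm Tp rhat (R n)) (psi n) (t, x))"
    and "rhobar \<equiv> \<lambda>n t. integral (cball (rhat t) (R n))
                        (\<lambda>x. charge_density c m q (chi n) (phi n) (OmegaHat Tm Tp rhat (R n)) (psi n) (t, x))"
    and "Q \<equiv> \<lambda>n z. (aC m c (chi n))\<^sup>2 * (norm (grad0 c (OmegaHat Tm Tp rhat (R n)) (psi n) z))\<^sup>2
                   + (aC m c (chi n))\<^sup>2 * \<bar>Ga G1 (a n) ((cmod (psi n z))\<^sup>2)\<bar>
                   + (cmod (psi n z))\<^sup>2"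
  assumes c_pos: "c > 0" and m_pos: "m > 0"
    (* nonlinearity G_1 with derivative G_1' = dG1 on (0,\<infinity>) *)
    and G1_0: "G1 0 = 0"
    and G1_deriv: "\<And>s. s > 0 \<Longrightarrow> (G1 has_real_derivative dG1 s) (at s)"
    and dG1_C1: "dG1 C1_differentiable_on {0<..}"
    and G1_holder1: "\<And>al. 0 < al \<Longrightarrow> al < 1 \<Longrightarrow>
         \<exists>F::complex \<Rightarrow> complex. locally_holder al F \<and>
            (\<forall>w. w \<noteq> 0 \<longrightarrow> F w = complex_of_real (dG1 ((cmod w)\<^sup>2)) * w)"
    and G1_holder2: "\<And>al. 0 < al \<Longrightarrow> al < 1 \<Longrightarrow> C1_holder al (\<lambda>w::complex. G1 ((cmod w)\<^sup>2))"
    and G1_bounds: "\<And>al C1. 0 < al \<Longrightarrow> al < 1 \<Longrightarrow>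
         \<exists>C. \<forall>w::complex. cmod w \<le> C1 \<longrightarrow>
              \<bar>G1 ((cmod w)\<^sup>2)\<bar> \<le> C * cmod w powr (1 + al) \<and>
              \<bar>dG1 ((cmod w)\<^sup>2)\<bar> * cmod w \<le> C * cmod w powr al"
    (* trajectory *)
    and T_less: "Tm < Tp"
    and rhat_C2: "C2_within rhat I"
    and rhat_bds: "\<exists>C. \<forall>t\<in>I. norm (vector_derivative rhat (at t within I)) \<le> C \<and>
         norm (vector_derivative (\<lambda>s. vector_derivative rhat (at s within I)) (at t within I)) \<le> C"
    and R_pos: "\<And>n. R n > 0" and R_lim: "R \<longlonglongrightarrow> 0"
    (* localized KG equations *)
    and a_pos: "\<And>n. a n > 0" and a_lim: "a \<longlonglongrightarrow> 0"
    and chi_pos: "\<And>n. chi n > 0" and chi_lim: "chi \<longlonglongrightarrow> 0"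
    and aC_a: "\<exists>C. \<forall>n. aC m c (chi n) / a n \<le> C"
    and R_a: "filterlim (\<lambda>n. R n / a n) at_top sequentially"
    and phi_C2: "\<And>n. C2_within (phi n) (Om n)"
    and phi_bd: "\<exists>C. \<forall>n. \<forall>z\<in>Om n. \<bar>phi n z\<bar> + norm (grad0 c (Om n) (phi n) z) \<le> C"
    and phiinf_form: "\<And>t x. t \<in> I \<Longrightarrow> phiinf (t, x) = phiinf (t, rhat t) + (x - rhat t) \<bullet> ginf t"
    and phiinf_diff: "phiinf differentiable_on (I \<times> UNIV)"
    and ginf_diff: "ginf differentiable_on I"
    and phi_conv: "\<And>e. e > 0 \<Longrightarrow> eventually (\<lambda>n. \<forall>z\<in>Om n.
           \<bar>phi n z - phiinf z\<bar> + norm (grad0 c (Om n) (phi n) z - grad0 c (Om n) phiinf z) \<le> e)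
         sequentially"
    and phiinf_bd: "\<exists>C. \<forall>t\<in>I. \<bar>phiinf (t, rhat t)\<bar> \<le> C \<and> norm (ginf t) \<le> C \<and>
         norm (vector_derivative ginf (at t within I)) \<le> C"
    (* concentrating solutions *)
    and psi_C2: "\<And>n. C2_within (psi n) (Om n)"
    and psi_KG: "\<And>n. KG_eq c m q dG1 (chi n) (a n) (phi n) (Om n) (psi n)"
    and cond_i: "\<exists>C. \<forall>n. \<forall>t\<in>I. integral (cball (rhat t) (R n)) (\<lambda>x. Q n (t, x)) \<le> C"
    and cond_ii: "\<And>e. e > 0 \<Longrightarrow> eventually (\<lambda>n. \<forall>t\<in>I.
           sphere_integral (rhat t) (R n) (\<lambda>x. Q n (t, x)) \<le> e) sequentially"
    and cond_iii: "\<exists>c0>0. \<exists>n0. \<forall>n\<ge>n0. \<forall>t\<in>I. Ebar n t \<ge> c0"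
    and cond_iv: "t0 \<in> I" "(\<lambda>n. Ebar n t0) \<longlonglongrightarrow> Einf0"
    (* charge convergence *)
    and rho_lim: "(\<lambda>n. rhobar n t0) \<longlonglongrightarrow> rhoinf"
  shows "uniform_limit I Ebar
           (\<lambda>t. Einf0 - rhoinf * (LBINT s = ereal t0..ereal t.
                   vector_derivative rhat (at s within I) \<bullet> ginf s))
           sequentially"
proof -
  define v where "v t = vector_derivative rhat (at t within I)" for t
  obtain r1 r2 where r1: "C1_on rhat r1 I"
    using C2_within_C1_on[OF rhat_C2] by metis
  have rhat: "(rhat has_vector_derivative r1 t 1) (at t within I)" if "t \<in> I" for t
  proof -
    have d: "(rhat has_derivative r1 t) (at t within I)" by (rule C1_onD(1)[OF r1 that])
    have "r1 t h = h *\<^sub>R r1 t 1" for h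
      using linear_simps(5)[OF has_derivative_bounded_linear[OF d], of h 1] by simp
    then show ?thesis
      unfolding has_vector_derivative_def by (intro has_derivative_eq_rhs[OF d] ext)
  qed
  have v: "v t = r1 t 1" if "t \<in> I" for t
    using vector_derivative_within_closed_interval[OF T_less] rhat[OF that] that unfolding v_def I_def by blast
  have vc: "continuous_on I v"
    by (rule continuous_on_eq[OF C1_onD(2)[OF r1]]) (rule v[symmetric])
  have tube: "tube Tm Tp (R n) rhat v" for n
    using T_less R_pos vc rhat v by unfold_locales (auto simp: I_def)
  obtain V where V: "\<And>t. t \<in> I \<Longrightarrow> norm (v t) \<le> V"
    using rhat_bds unfolding v_def by blast
  define ginf' where "ginf' t = vector_derivative ginf (at t within I)" for t
  have ginf: "(ginf has_vector_derivative ginf' t) (at t within I)" if "t \<in> I" for t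
    using ginf_diff that unfolding ginf'_def differentiable_on_def by (simp add: vector_derivative_works)
  obtain G where G: "\<And>t. t \<in> I \<Longrightarrow> norm (ginf t) \<le> G" "\<And>t. t \<in> I \<Longrightarrow> norm (ginf' t) \<le> G"
    using phiinf_bd unfolding ginf'_def by blast
  obtain B where B: "\<And>n z. z \<in> Om n \<Longrightarrow> \<bar>phi n z\<bar> + norm (grad0 c (Om n) (phi n) z) \<le> B"
    using phi_bd by blast
  obtain M where M: "\<And>n t. t \<in> I \<Longrightarrow> integral (cball (rhat t) (R n)) (\<lambda>x. Q n (t, x)) \<le> M"
    using cond_i by blast
  \<comment> \<open>These constants repeat those of \<open>energy_deviation\<close>;
    \<open>B\<close>, \<open>V\<close>, \<open>G\<close> and \<open>M\<close> are uniform in n,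
    hence so is \<open>K\<close>.\<close>
  define KE where "KE = 2 * m * c\<^sup>2 + q\<^sup>2 * B\<^sup>2 / (m * c\<^sup>2)"
  define L where "L = (1 + c + \<bar>q\<bar> / (m * c\<^sup>2) + \<bar>q\<bar> / (m * c)) * KE"
  define LV where "LV = L + L * V"
  define N where "N = 1 + (Tp - Tm) * LV"
  define A where "A = LV + L * M + 3 * (G * (L * M)) + 3 * (G * LV) + V * G * N"
  define K where "K = 1 + 6 * (G * (L * M)) + (Tp - Tm) * A"
  let ?E = "\<lambda>t. Einf0 - rhoinf * (LBINT s=ereal t0..ereal t. v s \<bullet> ginf s)"
  have main: "\<bar>Ebar n t - ?E t\<bar> \<le> K * d"
    if t: "t \<in> I"
      and sphere: "\<And>t. t \<in> I \<Longrightarrow> sphere_integral (rhat t) (R n) (\<lambda>x. Q n (t, x)) \<le> d"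
      and field: "\<And>z. z \<in> Om n \<Longrightarrow> \<bar>phi n z - phiinf z\<bar> + norm (grad0 c (Om n) (phi n) z - grad0 c (Om n) phiinf z) \<le> d"
      and Rd: "R n \<le> d" "R n \<le> 1"
      and rho: "\<bar>rhobar n t0 - rhoinf\<bar> \<le> d" and En: "\<bar>Ebar n t0 - Einf0\<bar> \<le> d"
    for n d t
  proof -
    interpret tb: tube Tm Tp "R n" rhat v by (rule tube)
    obtain phi1 where phi1: "C1_on (phi n) phi1 (Om n)"
      using C2_within_C1_on[OF phi_C2] by metis
    obtain psi1 psi2 where psi1: "C1_on (psi n) psi1 (Om n)" "\<And>k. C1_on (\<lambda>z. psi1 z k) (\<lambda>z h. psi2 z h k) (Om n)"
      using C2_within_C1_on[OF psi_C2] by metis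
    \<comment> \<open>Any exponent in (0, 1) serves: what is drawn from it is the continuity of the
      derivative.\<close>
    have hol: "C1_holder (1/2) (\<lambda>w::complex. G1 ((cmod w)\<^sup>2))"
      by (rule G1_holder2) auto
    note Gf = Ga_facts[OF a_pos G1_deriv hol]
    interpret kg: kg_tube Tm Tp "R n" rhat v c m q "chi n" "a n" G1 dG1 "phi n" phi1 "psi n" psi1 psi2
      by unfold_locales
        (use c_pos m_pos chi_pos phi1 psi1 Gf psi_KG in \<open>auto simp: Om_def\<close>)
    have Om: "Om n = OmegaHat Tm Tp rhat (R n)" by (simp add: Om_def)
    have Q: "Q n (s, x) = kg.Qn (s, x)" if "s \<in> I" "x \<in> cball (rhat s) (R n)" for s x
      unfolding Q_def using that by (intro kg.Qn_eq) (auto simp: tb.mem_S I_def)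
    have Ebar: "Ebar n s = integral (cball (rhat s) (R n)) (\<lambda>x. kg.En (s, x))" if "s \<in> I" for s
      unfolding Ebar_def using that by (intro integral_cong kg.energy_density_eq) (auto simp: tb.mem_S I_def)
    have rhobar: "rhobar n s = integral (cball (rhat s) (R n)) (\<lambda>x. kg.Rn (s, x))" if "s \<in> I" for s
      unfolding rhobar_def using that by (intro integral_cong kg.charge_density_eq) (auto simp: tb.mem_S I_def)
    have "\<bar>integral (cball (rhat t) (R n)) (\<lambda>x. kg.En (t, x)) - ?E t\<bar> \<le> K * d"
      unfolding K_def A_def N_def LV_def L_def KE_def
    proof (rule kg.energy_deviation[where ginf' = ginf'])
      fix z assume z: "z \<in> OmegaHat Tm Tp rhat (R n)"
      show "\<bar>phi n z\<bar> \<le> B"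
        using B[of z n] z norm_ge_zero[of "grad0 c (Om n) (phi n) z"] unfolding Om by linarith
      obtain s x where sx: "z = (s, x)" by (cases z)
      have s: "s \<in> I" using z by (simp add: sx tb.mem_S I_def)
      have "phiinf differentiable (at z within I \<times> UNIV)"
        using phiinf_diff s by (simp add: differentiable_on_def sx)
      then obtain f' where "(phiinf has_derivative f') (at z within I \<times> UNIV)"
        by (auto simp: differentiable_def)
      then have "(phiinf has_derivative f') (at z within OmegaHat Tm Tp rhat (R n))"
        by (rule has_derivative_subset) (auto simp: OmegaHat_def I_def)
      then have "grad (OmegaHat Tm Tp rhat (R n)) phiinf z = ginf s"
        unfolding sx by (rule tb.grad_affine[OF _ z[unfolded sx] phiinf_form[OF s]])
      moreover have "grad (OmegaHat Tm Tp rhat (R n)) (phi n) z = (\<chi> i. phi1 z (0, axis i 1))"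
        by (simp add: grad_def kg.pd_eq[OF z])
      moreover have "norm (grad (Om n) (phi n) z - grad (Om n) phiinf z) \<le> norm (grad0 c (Om n) (phi n) z - grad0 c (Om n) phiinf z)"
        unfolding grad0_def diff_Pair by (rule norm_snd_le)
      ultimately show "norm ((\<chi> i. phi1 z (0, axis i 1)) - ginf (fst z)) \<le> d"
        using field[of z] z unfolding Om sx by simp
    next
      fix s assume s: "s \<in> {Tm..Tp}"
      then have sI: "s \<in> I" by (simp add: I_def)
      show "norm (v s) \<le> V" "norm (ginf s) \<le> G" "norm (ginf' s) \<le> G"
        using V G sI by auto
      show "(ginf has_vector_derivative ginf' s) (at s within {Tm..Tp})"
        using ginf[OF sI] by (simp add: I_def)
      show "integral (cball (rhat s) (R n)) (\<lambda>x. kg.Qn (s, x)) \<le> M"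
      proof -
        have "integral (cball (rhat s) (R n)) (\<lambda>x. Q n (s, x)) = integral (cball (rhat s) (R n)) (\<lambda>x. kg.Qn (s, x))"
          by (rule integral_cong) (rule Q[OF sI])
        then show ?thesis using M[OF sI, of n] by linarith
      qed
      show "sphere_integral (rhat s) (R n) (\<lambda>x. kg.Qn (s, x)) \<le> d"
      proof -
        have "sphere_integral (rhat s) (R n) (\<lambda>x. Q n (s, x)) = sphere_integral (rhat s) (R n) (\<lambda>x. kg.Qn (s, x))"
          by (rule sphere_integral_cong[OF _ R_pos]) (rule Q[OF sI])
        then show ?thesis using sphere[OF sI] by linarith
      qed
    qed (use Rd t cond_iv rho En Ebar rhobar in \<open>auto simp: I_def\<close>)
    then show ?thesis by (simp only: Ebar[OF t])
  qed
  have "uniform_limit I Ebar ?E sequentially"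
  proof (rule uniform_limitI)
    fix e :: real assume e: "e > 0"
    \<comment> \<open>Makes K d < e strictly; with the absolute value and the summand 1, no
      information on the sign of \<open>K\<close> is required.\<close>
    define d where "d = e / (2 * (\<bar>K\<bar> + 1))"
    have d: "d > 0" using e by (simp add: d_def add_nonneg_pos)
    have "K * d \<le> \<bar>K\<bar> * d" using d by (intro mult_right_mono) auto
    also have "\<dots> < (2 * (\<bar>K\<bar> + 1)) * d" using d by (intro mult_strict_right_mono) auto
    also have "\<dots> = e" by (simp add: d_def)
    finally have Kd: "K * d < e" .
    have "\<forall>\<^sub>F n in sequentially. R n < d" "\<forall>\<^sub>F n in sequentially. R n < 1"
      using order_tendstoD(2)[OF R_lim] d by auto
    moreover have "\<forall>\<^sub>F n in sequentially. dist (rhobar n t0) rhoinf < d" "\<forall>\<^sub>F n in sequentially. dist (Ebar n t0) Einf0 < d"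
      using tendstoD[OF rho_lim d] tendstoD[OF cond_iv(2) d] .
    moreover note cond_ii[OF d] phi_conv[OF d]
    ultimately show "\<forall>\<^sub>F n in sequentially. \<forall>t\<in>I. dist (Ebar n t) (?E t) < e"
    proof eventually_elim
      case (elim n)
      have "\<bar>Ebar n t - ?E t\<bar> \<le> K * d" if "t \<in> I" for t
        by (rule main[OF that]) (use elim in \<open>auto simp: dist_real_def\<close>)
      then show ?case using Kd by (fastforce simp: dist_real_def)
    qed
  qed
  then show ?thesis by (simp only: v_def)
qed

end
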